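(* If $0<q<p<\infty$ and $q<2$, then $\mathcal M(\mathcal D^p_{p-1}\cap BMOA,\ \mathcal D^q_{q-1}\cap BMOA)=\{0\}$.
   Context: $\mathbb D$ is the open unit disc, $dA=\frac1\pi dx\,dy$. For $0<p<\infty$, $\mathcal D^p_{p-1}$ is the space of analytic $f$ with $\int_{\mathbb D}(1-|z|)^{p-1}|f'(z)|^p\,dA(z)<\infty$. $BMOA$ is the space of $f\in H^1$ whose boundary values have bounded mean oscillation. $\mathcal M(X,Y)=\{g\text{ analytic in }\mathbb D: fg\in Y\ \forall f\in X\}$. *)

theory Defs
  imports "HOL-Analysis.Analysis"
begin

text \<open>Unit disc \<open>ball 0 1\<close>; analytic functions are functions holomorphic on it.
  Normalised area measure dA = (1/pi) dx dy.\<close>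

definition dirichlet_type :: "real \<Rightarrow> (complex \<Rightarrow> complex) set" where
  "dirichlet_type p = {f. f holomorphic_on ball 0 1 \<and>
     (\<integral>\<^sup>+ z. indicator (ball 0 1) z *
        ennreal ((1 - norm z) powr (p - 1) * norm (deriv f z) powr p / pi) \<partial>lborel) < \<infinity>}"

definition hardy1 :: "(complex \<Rightarrow> complex) set" where
  "hardy1 = {f. f holomorphic_on ball 0 1 \<and>
     (\<exists>C. \<forall>r. 0 < r \<and> r < 1 \<longrightarrow>
        integral {0..2*pi} (\<lambda>\<theta>. norm (f (complex_of_real r * cis \<theta>))) / (2*pi) \<le> C)}"

text \<open>Boundary function: radial limit (exists a.e. for H^1 functions).\<close>
definition boundary_fun :: "(complex \<Rightarrow> complex) \<Rightarrow> real \<Rightarrow> complex" where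
  "boundary_fun f \<theta> = Lim (at_left 1) (\<lambda>r. f (complex_of_real r * cis \<theta>))"

text \<open>Bounded mean oscillation of a 2pi-periodic function on the circle,
  arcs being parameter intervals [a,b] of length at most 2pi.\<close>
definition bmo_circle :: "(real \<Rightarrow> complex) \<Rightarrow> bool" where
  "bmo_circle u \<longleftrightarrow> (\<forall>a b. a < b \<longrightarrow> set_integrable lborel {a..b} u) \<and>
     (\<exists>C. \<forall>a b. a < b \<and> b - a \<le> 2*pi \<longrightarrow>
        (LINT \<theta>:{a..b}|lborel. norm (u \<theta> - (LINT t:{a..b}|lborel. u t) / complex_of_real (b - a)))
          / (b - a) \<le> C)"

definition BMOA :: "(complex \<Rightarrow> complex) set" where
  "BMOA = {f. f \<in> hardy1 \<and> bmo_circle (boundary_fun f)}"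

definition multipliers :: "(complex \<Rightarrow> complex) set \<Rightarrow> (complex \<Rightarrow> complex) set \<Rightarrow> (complex \<Rightarrow> complex) set" where
  "multipliers X Y = {g. g holomorphic_on ball 0 1 \<and> (\<forall>f\<in>X. (\<lambda>z. f z * g z) \<in> Y)}"

end

(* Let g be a multiplier, not identically zero. Since 1 belongs to the domain space, g lies in
   D^q_{q-1}, so for every bounded f in D^p_{p-1} the function f' g is in L^q((1-|z|)^{q-1} dA).
   Take for f the limits F, G of weighted Rudin-Shapiro polynomials with frequencies L^n and weights
   b_n = (n+1)^{-1/q}. As q < 2 the b_n are square summable, and the unitarity behind the Rudin-Shapiro
   recursion makes F and G bounded, hence BMOA. Near |z| = 1 - 1/L^n the n-th block
   dominates F' and G': both are O(b_n L^n), so F and G are in D^p_{p-1} because the b_n^p are summable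
   for p > q, while |F'| + |G'| >= c b_n L^n there by unitarity again. Subharmonicity of |g|^q bounds
   the mean of |g|^q on these annuli below, so the integral of
   (1-|z|)^{q-1} (|F'|^q + |G'|^q) |g|^q dominates the divergent series of the b_n^q. *)

theory Submission
  imports Defs "HOL-Complex_Analysis.Complex_Analysis" "HOL-Real_Asymp.Real_Asymp"
begin

section \<open>Weighted Rudin-Shapiro polynomials\<close>

text \<open>The product rule shapes the argument: f' g = (f g)' - f g', and g in the target
  Dirichlet space controls f g' only when f is bounded. A plain lacunary series will not do: by
  Sidon's theorem it is bounded only if its coefficients are absolutely summable, which for q >= 1
  excludes the divergence of the series of the b_n^q. The Rudin-Shapiro factors \<open>Q\<close>
  give boundedness under mere square summability, at the price that a single block may vanish at
  some points; hence two functions, whose blocks cannot be small together. The constant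
  \<open>C\<close> bounds all the polynomials in the disc, \<open>K\<close> keeps the weights from
  dropping too fast between neighbouring scales, and L >= 10000 C K lets the n-th block beat the sum
  of all earlier and all later ones. The exponent 1/q of the weights is the endpoint: b_n^s is
  summable exactly for s > q, and both s = p and s = 2 are such.\<close>

locale gap_system =
  fixes b :: "nat \<Rightarrow> real" and L :: nat and C K :: real
  assumes b_pos: "0 < b j" and b_le_1: "b j \<le> 1" and b_decr: "b (Suc j) \<le> b j"
    and b_doubling: "b j \<le> K * b (Suc j)"
    and prod_le: "(\<Prod>j<n. 1 + (b j)\<^sup>2) \<le> C\<^sup>2"
    and C_ge_1: "1 \<le> C" and K_ge_1: "1 \<le> K" and L_large: "10000 * C * K \<le> real L"
begin

text \<open>On the unit circle, \<open>(P, Q)\<close> at stage \<open>n\<close> arises from \<open>(u, v)\<close> by a product of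
  \<open>n\<close> multiples of unitary matrices. The starts \<open>(1, 0)\<close> and \<open>(0, 1)\<close> give its two columns;
  its rows are orthogonal, so the two versions of \<open>Q\<close> cannot be small at the same point.\<close>

fun P Q :: "complex \<Rightarrow> complex \<Rightarrow> nat \<Rightarrow> complex \<Rightarrow> complex" where
  "P u v 0 z = u"
| "Q u v 0 z = v"
| "P u v (Suc j) z = P u v j z + of_real (b j) * z ^ (L ^ j) * Q u v j z"
| "Q u v (Suc j) z = z ^ (L ^ j) * Q u v j z - of_real (b j) * P u v j z"

text \<open>One recursion step multiplies the 2 by 2 matrix A with rows x and y from the left by M
  with rows (1, \<beta> w) and (-\<beta>, w). For |w| = 1 the product of M with its adjoint is 1 +
  \<beta>^2 times the identity, so A times its adjoint stays a multiple of the identity. Here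
  \<open>\<pi>\<close> is a free real number, not the circle constant.\<close>

lemma unitary_step:
  fixes x1 x2 y1 y2 w :: complex and \<beta> \<pi> :: real
  assumes w: "norm w = 1"
    and x: "x1 * cnj x1 + x2 * cnj x2 = of_real \<pi>"
    and y: "y1 * cnj y1 + y2 * cnj y2 = of_real \<pi>"
    and xy: "x1 * cnj y1 + x2 * cnj y2 = 0"
  defines "X1 \<equiv> x1 + of_real \<beta> * w * y1" and "X2 \<equiv> x2 + of_real \<beta> * w * y2"
    and "Y1 \<equiv> w * y1 - of_real \<beta> * x1" and "Y2 \<equiv> w * y2 - of_real \<beta> * x2"
  shows "X1 * cnj X1 + X2 * cnj X2 = of_real ((1 + \<beta>\<^sup>2) * \<pi>)"
    and "Y1 * cnj Y1 + Y2 * cnj Y2 = of_real ((1 + \<beta>\<^sup>2) * \<pi>)"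
    and "X1 * cnj Y1 + X2 * cnj Y2 = 0"
proof -
  have ww: "w * cnj w = 1"
    using w by (simp add: complex_norm_square[symmetric])
  define a1 a2 where "a1 = w * y1" and "a2 = w * y2"
  have aa: "a1 * cnj a1 + a2 * cnj a2 = of_real \<pi>"
  proof -
    have "a1 * cnj a1 + a2 * cnj a2 = w * cnj w * (y1 * cnj y1 + y2 * cnj y2)"
      by (simp add: a1_def a2_def algebra_simps)
    then show ?thesis by (simp add: ww y)
  qed
  have xa: "x1 * cnj a1 + x2 * cnj a2 = 0"
  proof -
    have "x1 * cnj a1 + x2 * cnj a2 = cnj w * (x1 * cnj y1 + x2 * cnj y2)"
      by (simp add: a1_def a2_def algebra_simps)
    then show ?thesis by (simp add: xy)
  qed
  have ax: "a1 * cnj x1 + a2 * cnj x2 = 0"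
    using arg_cong[OF xa, of cnj] by (simp add: mult.commute)
  have X: "X1 = x1 + of_real \<beta> * a1" "X2 = x2 + of_real \<beta> * a2"
    and Y: "Y1 = a1 - of_real \<beta> * x1" "Y2 = a2 - of_real \<beta> * x2"
    by (simp_all add: X1_def X2_def Y1_def Y2_def a1_def a2_def)
  have "X1 * cnj X1 + X2 * cnj X2 = (x1 * cnj x1 + x2 * cnj x2) + of_real \<beta> * (x1 * cnj a1 + x2 * cnj a2)
     + of_real \<beta> * (a1 * cnj x1 + a2 * cnj x2) + (of_real \<beta>)\<^sup>2 * (a1 * cnj a1 + a2 * cnj a2)"
    unfolding X by (simp add: algebra_simps power2_eq_square)
  then show "X1 * cnj X1 + X2 * cnj X2 = of_real ((1 + \<beta>\<^sup>2) * \<pi>)"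
    unfolding x aa xa ax by (simp add: algebra_simps)
  have "Y1 * cnj Y1 + Y2 * cnj Y2 = (a1 * cnj a1 + a2 * cnj a2) - of_real \<beta> * (x1 * cnj a1 + x2 * cnj a2)
     - of_real \<beta> * (a1 * cnj x1 + a2 * cnj x2) + (of_real \<beta>)\<^sup>2 * (x1 * cnj x1 + x2 * cnj x2)"
    unfolding Y by (simp add: algebra_simps power2_eq_square)
  then show "Y1 * cnj Y1 + Y2 * cnj Y2 = of_real ((1 + \<beta>\<^sup>2) * \<pi>)"
    unfolding x aa xa ax by (simp add: algebra_simps)
  have "X1 * cnj Y1 + X2 * cnj Y2 = (x1 * cnj a1 + x2 * cnj a2) - of_real \<beta> * (x1 * cnj x1 + x2 * cnj x2)
     + of_real \<beta> * (a1 * cnj a1 + a2 * cnj a2) - (of_real \<beta>)\<^sup>2 * (a1 * cnj x1 + a2 * cnj x2)"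
    unfolding X Y by (simp add: algebra_simps power2_eq_square)
  then show "X1 * cnj Y1 + X2 * cnj Y2 = 0"
    unfolding x aa xa ax by simp
qed

definition energy :: "nat \<Rightarrow> real" where "energy n = (\<Prod>j<n. 1 + (b j)\<^sup>2)"

text \<open>The matrix with rows \<open>P 1 0\<close>, \<open>P 0 1\<close> and
  \<open>Q 1 0\<close>, \<open>Q 0 1\<close> starts as the identity, and each step multiplies its
  product with its adjoint by 1 + (b n)^2.\<close>

lemma rows_orthogonal:
  assumes "norm z = 1"
  shows "P 1 0 n z * cnj (P 1 0 n z) + P 0 1 n z * cnj (P 0 1 n z) = of_real (energy n) \<and>
    Q 1 0 n z * cnj (Q 1 0 n z) + Q 0 1 n z * cnj (Q 0 1 n z) = of_real (energy n) \<and>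
    P 1 0 n z * cnj (Q 1 0 n z) + P 0 1 n z * cnj (Q 0 1 n z) = 0"
proof (induction n)
  case 0
  then show ?case by (simp add: energy_def)
next
  case (Suc n)
  have w: "norm (z ^ (L ^ n)) = 1"
    using assms by (simp add: norm_power)
  have e: "energy (Suc n) = (1 + (b n)\<^sup>2) * energy n"
    by (simp add: energy_def mult.commute)
  show ?case
    unfolding e P.simps Q.simps
    using unitary_step[OF w, of "P 1 0 n z" "P 0 1 n z" "energy n" "Q 1 0 n z" "Q 0 1 n z" "b n"] Suc
    by blast
qed

lemma energy_ge_1: "1 \<le> energy n"
  unfolding energy_def by (intro prod_ge_1) simp

lemma circle_energy:
  assumes "norm z = 1"
  shows "(norm (P 1 0 n z))\<^sup>2 + (norm (P 0 1 n z))\<^sup>2 = energy n"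
    and "(norm (Q 1 0 n z))\<^sup>2 + (norm (Q 0 1 n z))\<^sup>2 = energy n"
proof -
  have "complex_of_real ((norm (P 1 0 n z))\<^sup>2 + (norm (P 0 1 n z))\<^sup>2) = of_real (energy n)"
    "complex_of_real ((norm (Q 1 0 n z))\<^sup>2 + (norm (Q 0 1 n z))\<^sup>2) = of_real (energy n)"
    unfolding of_real_add complex_norm_square using rows_orthogonal[OF assms, of n] by blast+
  then show "(norm (P 1 0 n z))\<^sup>2 + (norm (P 0 1 n z))\<^sup>2 = energy n"
    "(norm (Q 1 0 n z))\<^sup>2 + (norm (Q 0 1 n z))\<^sup>2 = energy n"
    by (simp_all only: of_real_eq_iff)
qed

definition start :: "complex \<Rightarrow> complex \<Rightarrow> bool" where
  "start u v \<longleftrightarrow> (u = 1 \<and> v = 0) \<or> (u = 0 \<and> v = 1)"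

lemma holomorphic_PQ: "P u v n holomorphic_on S" "Q u v n holomorphic_on S"
proof (induction n)
  case 0
  { case 1 then show ?case by simp }
  { case 2 then show ?case by simp }
next
  case (Suc n)
  { case 1 then show ?case using Suc unfolding P.simps by (intro holomorphic_intros) }
  { case 2 then show ?case using Suc unfolding Q.simps by (intro holomorphic_intros) }
qed

text \<open>On the circle each entry is at most the square root of \<open>energy n\<close>, hence at
  most \<open>C\<close>. Inside the disc unitarity is lost, and the maximum modulus principle takes
  over.\<close>

lemma bounded_PQ:
  assumes "start u v" "norm z \<le> 1"
  shows "norm (P u v n z) \<le> C" "norm (Q u v n z) \<le> C"
proof -
  have sq: "energy n \<le> C\<^sup>2"
    unfolding energy_def by (rule prod_le)
  have *: "norm (P u v n z) \<le> C \<and> norm (Q u v n z) \<le> C" if "norm z = 1" for z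
    using assms(1) circle_energy[OF that, of n] sq C_ge_1 unfolding start_def
    by (smt (verit) power2_le_imp_le zero_le_power2)
  show "norm (P u v n z) \<le> C"
    by (rule maximum_modulus_frontier[where S = "cball 0 1"])
       (use * assms(2) in \<open>auto intro!: holomorphic_on_imp_continuous_on holomorphic_PQ\<close>)
  show "norm (Q u v n z) \<le> C"
    by (rule maximum_modulus_frontier[where S = "cball 0 1"])
       (use * assms(2) in \<open>auto intro!: holomorphic_on_imp_continuous_on holomorphic_PQ\<close>)
qed

lemma L_ge: "10000 \<le> real L" "10000 * K \<le> real L" "10000 * C \<le> real L"
proof -
  have "1 * 1 \<le> C * K" "1 * K \<le> C * K" "C * 1 \<le> C * K"
    using C_ge_1 K_ge_1 by (intro mult_mono; simp)+
  then show "10000 \<le> real L" "10000 * K \<le> real L" "10000 * C \<le> real L"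
    using L_large by auto
qed

section \<open>Size of the derivatives at stage n\<close>

lemma has_derivative_PQ:
  "(P u v n has_field_derivative deriv (P u v n) z) (at z)"
  "(Q u v n has_field_derivative deriv (Q u v n) z) (at z)"
  by (auto intro!: holomorphic_derivI[OF holomorphic_PQ(1), of UNIV] holomorphic_derivI[OF holomorphic_PQ(2), of UNIV])

lemma deriv_power_mult_Q:
  "((\<lambda>z. z ^ (L ^ n) * Q u v n z) has_field_derivative
     (of_nat (L ^ n) * z ^ (L ^ n - 1) * Q u v n z + z ^ (L ^ n) * deriv (Q u v n) z)) (at z)"
  by (rule derivative_eq_intros has_derivative_PQ refl | simp)+

lemma deriv_P_Suc:
  "deriv (P u v (Suc n)) z = deriv (P u v n) z + of_real (b n) *
     (of_nat (L ^ n) * z ^ (L ^ n - 1) * Q u v n z + z ^ (L ^ n) * deriv (Q u v n) z)"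
proof (rule DERIV_imp_deriv)
  have "((\<lambda>z. P u v n z + of_real (b n) * (z ^ (L ^ n) * Q u v n z)) has_field_derivative
      deriv (P u v n) z + of_real (b n) *
     (of_nat (L ^ n) * z ^ (L ^ n - 1) * Q u v n z + z ^ (L ^ n) * deriv (Q u v n) z)) (at z)"
    by (intro DERIV_add has_derivative_PQ DERIV_cmult deriv_power_mult_Q)
  moreover have "P u v (Suc n) = (\<lambda>z. P u v n z + of_real (b n) * (z ^ (L ^ n) * Q u v n z))"
    by (simp add: fun_eq_iff mult.assoc)
  ultimately show "(P u v (Suc n) has_field_derivative deriv (P u v n) z + of_real (b n) *
     (of_nat (L ^ n) * z ^ (L ^ n - 1) * Q u v n z + z ^ (L ^ n) * deriv (Q u v n) z)) (at z)"
    by simp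
qed

lemma deriv_Q_Suc:
  "deriv (Q u v (Suc n)) z =
     (of_nat (L ^ n) * z ^ (L ^ n - 1) * Q u v n z + z ^ (L ^ n) * deriv (Q u v n) z)
      - of_real (b n) * deriv (P u v n) z"
proof (rule DERIV_imp_deriv)
  have "((\<lambda>z. z ^ (L ^ n) * Q u v n z - of_real (b n) * P u v n z) has_field_derivative
      (of_nat (L ^ n) * z ^ (L ^ n - 1) * Q u v n z + z ^ (L ^ n) * deriv (Q u v n) z)
      - of_real (b n) * deriv (P u v n) z) (at z)"
    by (intro DERIV_diff has_derivative_PQ DERIV_cmult deriv_power_mult_Q)
  moreover have "Q u v (Suc n) = (\<lambda>z. z ^ (L ^ n) * Q u v n z - of_real (b n) * P u v n z)"
    by (simp add: fun_eq_iff mult.assoc)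
  ultimately show "(Q u v (Suc n) has_field_derivative (of_nat (L ^ n) * z ^ (L ^ n - 1) * Q u v n z + z ^ (L ^ n) * deriv (Q u v n) z)
      - of_real (b n) * deriv (P u v n) z) (at z)"
    by simp
qed

lemma norm_deriv_power_mult_Q:
  assumes "start u v" "norm z \<le> 1"
  shows "norm (of_nat (L ^ n) * z ^ (L ^ n - 1) * Q u v n z + z ^ (L ^ n) * deriv (Q u v n) z)
    \<le> (C * L ^ n + norm (deriv (Q u v n) z)) * norm z ^ (L ^ n - 1)"
proof -
  have a: "norm (of_nat (L ^ n) * z ^ (L ^ n - 1) * Q u v n z) \<le> real (L ^ n) * norm z ^ (L ^ n - 1) * C"
    unfolding norm_mult norm_power norm_of_nat
    by (intro mult_left_mono bounded_PQ assms) simp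
  have c: "norm (z ^ (L ^ n) * deriv (Q u v n) z) \<le> norm z ^ (L ^ n - 1) * norm (deriv (Q u v n) z)"
    unfolding norm_mult norm_power
    by (intro mult_right_mono power_decreasing) (use assms in auto)
  show ?thesis
    using norm_triangle_le[OF add_mono[OF a c]] by (simp add: algebra_simps)
qed

text \<open>The polynomials of stage n have degree about L^(n-1), so their derivatives are of lower
  order than L^n. The bound is an exact solution of D (n + 1) = 2 D n + C L^n, the recursion read
  off from the derivative formulas with b n <= 1; this is the origin of L - 2. The gain of a factor
  1 / L makes \<open>Q u v n\<close> almost constant at the scale 1 / L^n.\<close>

lemma deriv_PQ_bound:
  assumes "start u v" "norm z \<le> 1"
  shows "norm (deriv (P u v n) z) \<le> C * L ^ n / (real L - 2) \<and> norm (deriv (Q u v n) z) \<le> C * L ^ n / (real L - 2)"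
proof (induction n)
  case 0
  have "P u v 0 = (\<lambda>_. u)" "Q u v 0 = (\<lambda>_. v)"
    by auto
  then show ?case using L_ge C_ge_1 by simp
next
  case (Suc n)
  define D where "D = C * L ^ n / (real L - 2)"
  have IH: "norm (deriv (P u v n) z) \<le> D" "norm (deriv (Q u v n) z) \<le> D"
    using Suc by (auto simp: D_def)
  have D0: "0 \<le> D"
    using L_ge C_ge_1 by (auto simp: D_def)
  have T: "norm (of_nat (L ^ n) * z ^ (L ^ n - 1) * Q u v n z + z ^ (L ^ n) * deriv (Q u v n) z) \<le> C * L ^ n + D"
    (is "norm ?T \<le> _")
  proof -
    have "(C * L ^ n + norm (deriv (Q u v n) z)) * norm z ^ (L ^ n - 1) \<le> (C * L ^ n + D) * 1"
      by (intro mult_mono power_le_one add_left_mono IH) (use C_ge_1 D0 assms in auto)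
    then show ?thesis
      using order_trans[OF norm_deriv_power_mult_Q[OF assms, of n]] unfolding mult_1_right by blast
  qed
  have bT: "norm (of_real (b n) * ?T) \<le> C * L ^ n + D"
    using mult_mono[of "b n" 1 "norm ?T" "C * L ^ n + D"] b_pos[of n] b_le_1[of n] T C_ge_1 D0
    by (simp add: norm_mult)
  have bP: "norm (of_real (b n) * deriv (P u v n) z) \<le> D"
    using mult_mono[of "b n" 1 "norm (deriv (P u v n) z)" D] b_pos[of n] b_le_1[of n] IH D0
    by (simp add: norm_mult)
  have eq: "C * L ^ Suc n / (real L - 2) = 2 * D + C * L ^ n"
  proof -
    have "l * x / (l - 2) * C = 2 * (C * x / (l - 2)) + C * x" if "l > 2" for l x :: real
      using that by (simp add: field_simps)
    from this[of "real L" "real L ^ n"] show ?thesis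
      unfolding D_def using L_ge by (simp add: ac_simps)
  qed
  have nt: "norm (a + c) \<le> 2 * D + M \<and> norm (t - p) \<le> 2 * D + M"
    if "norm a \<le> D" "norm c \<le> M + D" "norm t \<le> M + D" "norm p \<le> D" for a c t p :: complex and M
    using that norm_triangle_ineq[of a c] norm_triangle_ineq4[of t p] by linarith
  show ?case
    unfolding deriv_P_Suc deriv_Q_Suc eq
    using nt[OF IH(1) bT T bP] .
qed

text \<open>The derivative of the \<open>n\<close>-th block \<open>z ^ (L ^ n) * Q u v n z\<close>.\<close>

definition block' :: "complex \<Rightarrow> complex \<Rightarrow> nat \<Rightarrow> complex \<Rightarrow> complex" where
  "block' u v n z = of_nat (L ^ n) * z ^ (L ^ n - 1) * Q u v n z + z ^ (L ^ n) * deriv (Q u v n) z"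

text \<open>The power of |z| is kept in the bound because it makes the blocks negligible whose scale
  1 / L^n is far below 1 - |z|.\<close>

lemma norm_block':
  assumes "start u v" "norm z \<le> 1"
  shows "norm (block' u v n z) \<le> 2 * C * (L ^ n * norm z ^ (L ^ n - 1))"
proof -
  have "norm (deriv (Q u v n) z) \<le> C * L ^ n / (real L - 2)"
    using deriv_PQ_bound[OF assms] by blast
  also have "\<dots> \<le> C * L ^ n / 1"
    using L_ge C_ge_1 by (intro divide_left_mono) auto
  finally have "(C * L ^ n + norm (deriv (Q u v n) z)) * norm z ^ (L ^ n - 1)
      \<le> (C * L ^ n + C * L ^ n) * norm z ^ (L ^ n - 1)"
    by (intro mult_right_mono) auto
  with norm_deriv_power_mult_Q[OF assms, of n] have "norm (block' u v n z)
      \<le> (C * L ^ n + C * L ^ n) * norm z ^ (L ^ n - 1)"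
    unfolding block'_def by (rule order_trans)
  then show ?thesis by (simp add: algebra_simps)
qed

lemma norm_block'_le:
  assumes "start u v" "norm z \<le> 1"
  shows "norm (block' u v n z) \<le> 2 * C * L ^ n"
proof -
  have "norm z ^ (L ^ n - 1) \<le> 1"
    using assms by (intro power_le_one) auto
  then have "2 * C * (L ^ n * norm z ^ (L ^ n - 1)) \<le> 2 * C * (real (L ^ n) * 1)"
    using C_ge_1 by (intro mult_left_mono) auto
  then show ?thesis
    using norm_block'[OF assms, of n] by simp
qed

section \<open>Head and tail of the series of block derivatives\<close>

lemma P_eq_sum: "P u v n z = u + (\<Sum>i<n. of_real (b i) * (z ^ (L ^ i) * Q u v i z))"
  by (induction n) (auto simp: mult.assoc)

lemma L_pow_ge_1: "1 \<le> real L ^ n"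
  using L_ge by (intro one_le_power) auto

text \<open>By the doubling condition b i * L^i grows at least by the factor L / K, so the head is
  dominated by the next term. The constant x = K / (L - K) solves x = (K / L) (x + 1), which is the
  induction step.\<close>

lemma head_sum: "(\<Sum>i<n. b i * L ^ i) \<le> b n * L ^ n * (K / (L - K))"
proof (induction n)
  case 0
  then show ?case using b_pos[of 0] L_ge K_ge_1 by simp
next
  case (Suc n)
  have LK: "0 < L - K" using L_ge K_ge_1 by linarith
  have "(\<Sum>i<Suc n. b i * L ^ i) \<le> b n * L ^ n * (K / (L - K)) + b n * L ^ n"
    using Suc by simp
  also have "\<dots> = b n * (L ^ n * (L / (L - K)))"
    using LK by (simp add: field_simps)
  also have "\<dots> \<le> K * b (Suc n) * (L ^ n * (L / (L - K)))"
    using b_doubling LK by (intro mult_right_mono) auto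
  also have "\<dots> = b (Suc n) * L ^ Suc n * (K / (L - K))"
    by simp
  finally show ?case .
qed

text \<open>Put m = L^n and x = L^k. At distance at least 1 / m from the circle the power is at most
  exp (1 - x), and exp x >= x^2 / 2 with e <= 3 leaves m x times 6 / x^2, a geometric decay in
  k.\<close>

lemma tail_term:
  assumes "0 \<le> r" "r \<le> 1 - 1 / L ^ n"
  shows "real L ^ (n + k) * r ^ (L ^ (n + k) - 1) \<le> 6 * L ^ n / L ^ k"
proof -
  define m where "m = real L ^ n"
  define x where "x = real L ^ k"
  have m: "1 \<le> m" and x: "1 \<le> x"
    using L_pow_ge_1 by (auto simp: m_def x_def)
  have M: "real L ^ (n + k) = m * x"
    by (simp add: m_def x_def power_add)
  have "L ^ (n + k) \<ge> 1"
    using L_ge(1) by (intro one_le_power) simp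
  then have M1: "real (L ^ (n + k) - 1) = m * x - 1"
    using M by (simp add: of_nat_diff)
  have "r \<le> exp (- (1 / m))"
    using assms exp_ge_add_one_self[of "- (1 / m)"] by (simp add: m_def)
  then have "r ^ (L ^ (n + k) - 1) \<le> exp (- (1 / m)) ^ (L ^ (n + k) - 1)"
    by (intro power_mono assms)
  also have "\<dots> = exp (1 / m - x)"
    unfolding exp_of_nat_mult[symmetric] M1 using m by (simp add: field_simps)
  also have "\<dots> \<le> exp (1 - x)"
    using m by simp
  also have "\<dots> = exp 1 / exp x"
    by (rule exp_diff)
  also have "\<dots> \<le> 3 / (x\<^sup>2 / 2)"
    using exp_lower_Taylor_quadratic[of x] x exp_le by (intro frac_le) (auto simp: power2_eq_square)
  finally have "m * x * r ^ (L ^ (n + k) - 1) \<le> m * x * (3 / (x\<^sup>2 / 2))"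
    using m x by (intro mult_left_mono) auto
  also have "\<dots> = 6 * m / x"
    using x by (simp add: power2_eq_square)
  finally show ?thesis
    unfolding M by (simp add: m_def x_def)
qed

lemma norm_block'_tail:
  assumes "start u v" "norm z \<le> 1 - 1 / L ^ n"
  shows "norm (of_real (b (k + Suc n)) * block' u v (k + Suc n) z) \<le> 12 * C * (b n * L ^ n) / L * (1 / L) ^ k"
proof -
  have z: "norm z \<le> 1"
    using assms(2) by (smt (verit) divide_nonneg_nonneg of_nat_0_le_iff zero_le_power)
  have b: "b (k + Suc n) \<le> b n"
    using lift_Suc_antimono_le[of b n "k + Suc n"] b_decr by simp
  have "norm (block' u v (n + Suc k) z) \<le> 2 * C * (6 * L ^ n / L ^ Suc k)"
    using norm_block'[OF assms(1) z, of "n + Suc k"] tail_term[OF norm_ge_zero assms(2), of "Suc k"] C_ge_1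
      mult_left_mono[of _ _ "2 * C"] by fastforce
  then have "norm (of_real (b (k + Suc n)) * block' u v (k + Suc n) z) \<le> b n * (2 * C * (6 * L ^ n / L ^ Suc k))"
    unfolding norm_mult norm_of_real using b b_pos[of "k + Suc n"] b_pos[of n] C_ge_1
    by (intro mult_mono) (auto simp: add.commute)
  then show ?thesis by (simp add: power_one_over mult_ac)
qed

lemma tail_sum:
  assumes "start u v" "norm z \<le> 1 - 1 / L ^ n"
  shows "summable (\<lambda>k. norm (of_real (b (k + Suc n)) * block' u v (k + Suc n) z))"
    and "norm (\<Sum>k. of_real (b (k + Suc n)) * block' u v (k + Suc n) z) \<le> 24 * C / L * (b n * L ^ n)"
proof -
  have L1: "norm (1 / real L) < 1"
    using L_ge(1) by simp
  have s: "(\<lambda>k. 12 * C * (b n * L ^ n) / L * (1 / L) ^ k) sums (12 * C * (b n * L ^ n) / L * (1 / (1 - 1 / L)))"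
    by (intro sums_mult geometric_sums L1)
  show sn: "summable (\<lambda>k. norm (of_real (b (k + Suc n)) * block' u v (k + Suc n) z))"
    using norm_block'_tail[OF assms] by (intro summable_comparison_test'[OF sums_summable[OF s], of 0]) simp
  have "norm (\<Sum>k. of_real (b (k + Suc n)) * block' u v (k + Suc n) z)
      \<le> (\<Sum>k. norm (of_real (b (k + Suc n)) * block' u v (k + Suc n) z))"
    by (rule summable_norm[OF sn])
  also have "\<dots> \<le> 12 * C * (b n * L ^ n) / L * (1 / (1 - 1 / L))"
    using suminf_le[OF norm_block'_tail[OF assms] sn sums_summable[OF s]] sums_unique[OF s] by simp
  also have "\<dots> \<le> 12 * C * (b n * L ^ n) / L * 2"
    using L_ge(1) C_ge_1 b_pos[of n] by (intro mult_left_mono) (auto simp: field_simps)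
  finally show "norm (\<Sum>k. of_real (b (k + Suc n)) * block' u v (k + Suc n) z) \<le> 24 * C / L * (b n * L ^ n)"
    by simp
qed

text \<open>The series of the weighted blocks converges locally uniformly in the disc, so it may be
  differentiated term by term. The bound \<open>C\<close> survives because the partial sums, shifted
  by \<open>u\<close>, are the polynomials \<open>P u v n\<close>.\<close>

lemma limit_function:
  assumes "start u v"
  obtains F where "\<And>z. z \<in> ball 0 1 \<Longrightarrow> norm (F z) \<le> C" "F holomorphic_on ball 0 1"
    "\<And>z. z \<in> ball 0 1 \<Longrightarrow> (\<lambda>n. of_real (b n) * block' u v n z) sums deriv F z"
proof -
  have "\<exists>g g'. \<forall>x\<in>ball 0 1. ((\<lambda>n. of_real (b n) * (x ^ (L ^ n) * Q u v n x)) sums g x) \<and>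
      ((\<lambda>n. of_real (b n) * block' u v n x) sums g' x) \<and> (g has_field_derivative g' x) (at x)"
  proof (rule series_and_derivative_comparison_local)
    fix n x
    show "((\<lambda>x. of_real (b n) * (x ^ (L ^ n) * Q u v n x)) has_field_derivative of_real (b n) * block' u v n x) (at x)"
      unfolding block'_def by (intro DERIV_cmult deriv_power_mult_Q)
  next
    fix x :: complex assume "x \<in> ball 0 1"
    then have x: "norm x < 1" by simp
    define r where "r = (1 + norm x) / 2"
    have r: "norm x < r" "r < 1" "0 \<le> r" using x by (auto simp: r_def)
    have "norm (of_real (b n) * (y ^ (L ^ n) * Q u v n y)) \<le> C * r ^ n" if "y \<in> ball x (r - norm x) \<inter> ball 0 1" for n y
    proof -
      have "norm y \<le> norm x + dist x y"
        by (metis dist_norm norm_minus_commute norm_triangle_sub)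
      then have y: "norm y \<le> r" "norm y \<le> 1" using that by auto
      have "n \<le> L ^ n"
        using L_ge(1) by (intro less_imp_le power_gt_expt) auto
      then have "norm y ^ (L ^ n) \<le> r ^ n"
        using y r by (smt (verit) power_decreasing power_mono norm_ge_zero)
      then have "b n * (norm y ^ (L ^ n) * norm (Q u v n y)) \<le> 1 * (r ^ n * C)"
        using b_pos[of n] b_le_1[of n] r by (intro mult_mono bounded_PQ assms y) auto
      then show ?thesis
        using b_pos[of n] by (simp add: norm_mult norm_power mult.commute)
    qed
    moreover have "summable (\<lambda>n. C * r ^ n)"
      using r by (intro summable_mult summable_geometric) auto
    ultimately show "\<exists>d h. 0 < d \<and> summable h \<and> (\<forall>\<^sub>F n in sequentially. \<forall>y\<in>ball x d \<inter> ball 0 1.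
        norm (of_real (b n) * (y ^ (L ^ n) * Q u v n y)) \<le> h n)"
      using r by (intro exI[of _ "r - norm x"] exI[of _ "\<lambda>n. C * r ^ n"]) auto
  qed auto
  then obtain g g' where g: "\<And>x. x \<in> ball 0 1 \<Longrightarrow> (\<lambda>n. of_real (b n) * (x ^ (L ^ n) * Q u v n x)) sums g x"
    "\<And>x. x \<in> ball 0 1 \<Longrightarrow> (\<lambda>n. of_real (b n) * block' u v n x) sums g' x"
    "\<And>x. x \<in> ball 0 1 \<Longrightarrow> (g has_field_derivative g' x) (at x)"
    by blast
  have D: "((\<lambda>x. u + g x) has_field_derivative g' x) (at x)" if "x \<in> ball 0 1" for x
    using DERIV_add[OF DERIV_const g(3)[OF that], of u] by simp
  show thesis
  proof
    show "(\<lambda>x. u + g x) holomorphic_on ball 0 1"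
      using D has_field_derivative_at_within unfolding holomorphic_on_def field_differentiable_def by blast
    show "(\<lambda>n. of_real (b n) * block' u v n z) sums deriv (\<lambda>x. u + g x) z" if "z \<in> ball 0 1" for z
      using DERIV_imp_deriv[OF D[OF that]] g(2)[OF that] by simp
    show "norm (u + g z) \<le> C" if "z \<in> ball 0 1" for z
    proof -
      have "(\<lambda>n. P u v n z) \<longlonglongrightarrow> u + g z"
        unfolding P_eq_sum using g(1)[OF that] by (intro tendsto_intros) (simp add: sums_def)
      then show ?thesis
        using bounded_PQ(1)[OF assms, of z] that
        by (intro Lim_bounded[OF tendsto_norm]) (auto simp: less_imp_le)
    qed
  qed
qed

text \<open>At the outer radius 1 - 1 / L^(n + 1) block n + 1 is not yet damped, so the head
  includes it; the factor L is the price of expressing its size through b n * L^n.\<close>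

lemma deriv_limit_le:
  assumes "start u v" "norm z \<le> 1 - 1 / L ^ Suc n" "(\<lambda>n. of_real (b n) * block' u v n z) sums d"
  shows "norm d \<le> 50 * C * L * (b n * L ^ n)"
proof -
  let ?t = "\<lambda>n. of_real (b n) * block' u v n z"
  have z: "norm z \<le> 1"
    using assms(2) by (smt (verit) divide_nonneg_nonneg of_nat_0_le_iff zero_le_power)
  have "d = (\<Sum>k. ?t (k + Suc (Suc n))) + (\<Sum>i<Suc (Suc n). ?t i)"
    using suminf_split_initial_segment[OF sums_summable[OF assms(3)], of "Suc (Suc n)"] sums_unique[OF assms(3)]
    by simp
  then have "norm d \<le> norm (\<Sum>k. ?t (k + Suc (Suc n))) + norm (\<Sum>i<Suc (Suc n). ?t i)"
    by (simp only: norm_triangle_ineq)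
  also have "norm (\<Sum>k. ?t (k + Suc (Suc n))) \<le> 24 * C / L * (b (Suc n) * L ^ Suc n)"
    using tail_sum(2)[OF assms(1,2)] .
  also have "norm (\<Sum>i<Suc (Suc n). ?t i) \<le> (\<Sum>i<Suc (Suc n). 2 * C * (b i * L ^ i))"
    using norm_block'_le[OF assms(1) z] b_pos
    by (intro sum_norm_le) (simp add: norm_mult less_imp_le mult.left_commute[of _ "b _"] mult.assoc[symmetric] mult_left_mono)
  also have "\<dots> = 2 * C * ((\<Sum>i<Suc n. b i * L ^ i) + b (Suc n) * L ^ Suc n)"
    by (simp only: sum_distrib_left[symmetric] sum.lessThan_Suc)
  also have "\<dots> \<le> 2 * C * (b (Suc n) * L ^ Suc n * 1 + b (Suc n) * L ^ Suc n)"
  proof (intro mult_left_mono add_right_mono)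
    have "K / (L - K) \<le> 1" using L_ge K_ge_1 by (simp add: field_simps)
    then have "b (Suc n) * L ^ Suc n * (K / (L - K)) \<le> b (Suc n) * L ^ Suc n * 1"
      using b_pos[of "Suc n"] by (intro mult_left_mono) auto
    with head_sum[of "Suc n"] show "(\<Sum>i<Suc n. b i * L ^ i) \<le> b (Suc n) * L ^ Suc n * 1"
      by (rule order_trans)
  qed (use C_ge_1 in auto)
  also have "24 * C / L * (b (Suc n) * L ^ Suc n) + 2 * C * (b (Suc n) * L ^ Suc n * 1 + b (Suc n) * L ^ Suc n)
      = (24 * C / L + 4 * C) * (b (Suc n) * L ^ Suc n)"
    by (simp add: algebra_simps)
  also have "\<dots> \<le> (50 * C) * (b n * L ^ Suc n)"
  proof (intro mult_mono mult_right_mono b_decr)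
    have "24 * C / L \<le> 24 * C / 1"
      using L_ge(1) C_ge_1 by (intro divide_left_mono) auto
    then show "24 * C / L + 4 * C \<le> 50 * C"
      using C_ge_1 by simp
  qed (use C_ge_1 b_pos[of n] b_pos[of "Suc n"] in auto)
  finally show ?thesis by (simp add: mult_ac)
qed

section \<open>Lower bound for the derivative on thin annuli\<close>

text \<open>On the circle the two squares add up to \<open>energy n\<close> >= 1, so one of the
  moduli is at least 6 / 10, as 2 * 36 / 100 < 1. The radial move from the circle to z has length at
  most 2 / L^n and changes the value by at most 2 C / (L - 2) <= 1 / 100.\<close>

lemma norm_Q_near_circle:
  assumes "1 \<le> n" "1 - 2 / L ^ n \<le> norm z" "norm z < 1"
  obtains u v where "start u v" "1 / 2 \<le> norm (Q u v n z)"
proof -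
  have Ln: "4 \<le> real L ^ n"
    using order_trans[OF _ self_le_power[of "real L" n]] assms(1) L_ge(1) by simp
  then have "2 / real (L ^ n) \<le> 2 / 4"
    using L_ge(1) by (intro divide_left_mono) auto
  with assms have z: "norm z \<noteq> 0" by linarith
  define w where "w = z / of_real (norm z)"
  have w: "norm w = 1" using z by (simp add: w_def norm_divide)
  have dist: "norm (w - z) \<le> 2 / L ^ n"
  proof -
    have "of_real (norm z) * w = z"
      using z by (simp add: w_def)
    then have "w - z = of_real (1 - norm z) * w"
      by (simp add: left_diff_distrib)
    then have "norm (w - z) = 1 - norm z"
      using w assms(3) by (simp only: norm_mult norm_of_real) simp
    with assms(2) show ?thesis by simp
  qed
  have close: "norm (Q u v n w - Q u v n z) \<le> 1 / 100" if uv: "start u v" for u v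
  proof -
    have "norm (Q u v n w - Q u v n z) \<le> C * L ^ n / (real L - 2) * norm (w - z)"
    proof (rule field_differentiable_bound[where S = "cball 0 1"])
      fix x :: complex assume "x \<in> cball 0 1"
      then show "norm (deriv (Q u v n) x) \<le> C * L ^ n / (real L - 2)"
        using deriv_PQ_bound[OF uv, of x n] by auto
      show "(Q u v n has_field_derivative deriv (Q u v n) x) (at x within cball 0 1)"
        by (rule has_field_derivative_at_within[OF has_derivative_PQ(2)])
    qed (use w assms(3) in simp_all)
    also have "\<dots> \<le> C * L ^ n / (real L - 2) * (2 / L ^ n)"
      using dist C_ge_1 L_ge by (intro mult_left_mono) auto
    also have "\<dots> = 2 * C / (real L - 2)"
      using L_ge(1) by simp
    also have "\<dots> \<le> 1 / 100"
      using L_ge C_ge_1 by (simp add: field_simps)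
    finally show ?thesis .
  qed
  have "(norm (Q 1 0 n w))\<^sup>2 + (norm (Q 0 1 n w))\<^sup>2 \<ge> 1"
    using circle_energy(2)[OF w] energy_ge_1 by simp
  moreover have *: "(norm x)\<^sup>2 \<le> 36 / 100" if "norm x < 6 / 10" for x :: complex
    using power_mono[of "norm x" "6 / 10" 2] that by (simp add: power_divide)
  ultimately have "6 / 10 \<le> norm (Q 1 0 n w) \<or> 6 / 10 \<le> norm (Q 0 1 n w)"
    using *[of "Q 1 0 n w"] *[of "Q 0 1 n w"] by linarith
  then show thesis
  proof
    assume "6 / 10 \<le> norm (Q 1 0 n w)"
    then show thesis
      using close[of 1 0] norm_triangle_ineq2[of "Q 1 0 n w" "Q 1 0 n z"] by (intro that[of 1 0]) (auto simp: start_def)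
  next
    assume "6 / 10 \<le> norm (Q 0 1 n w)"
    then show thesis
      using close[of 0 1] norm_triangle_ineq2[of "Q 0 1 n w" "Q 0 1 n z"] by (intro that[of 0 1]) (auto simp: start_def)
  qed
qed

text \<open>With m = L^n and x = 2 / m, the bound ln (1 - x) >= -x - 2 x^2 >= -2 x for x <= 1 / 2
  gives (1 - x)^m >= exp (-4), and e <= 3 turns this into 1 / 81.\<close>

lemma power_near_circle:
  assumes "1 \<le> n" "1 - 2 / L ^ n \<le> r" "r < 1"
  shows "1 / 81 \<le> r ^ (L ^ n - 1)"
proof -
  define m where "m = L ^ n"
  have "4 \<le> real L ^ n"
    using order_trans[OF _ self_le_power[of "real L" n]] assms(1) L_ge(1) by simp
  then have m: "4 \<le> real m" by (simp add: m_def)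
  define x where "x = 2 / real m"
  have "x \<le> 2 / 4"
    using m unfolding x_def by (intro divide_left_mono) auto
  then have x: "0 \<le> x" "x \<le> 1 / 2" "1 - x \<le> r" "m * x = 2"
    using assms(2) m L_ge(1) by (auto simp: x_def m_def)
  have "x\<^sup>2 \<le> x * (1 / 2)"
    using mult_left_mono[OF x(2,1)] by (simp add: power2_eq_square)
  then have "- 2 * x \<le> ln (1 - x)"
    using ln_one_minus_pos_lower_bound[OF x(1,2)] by simp
  then have "exp (- 2 * x) \<le> 1 - x"
    using x by (subst (asm) ln_ge_iff) auto
  then have "exp (- 2 * x) ^ m \<le> r ^ m"
    using x by (intro power_mono) auto
  also have "exp (- 2 * x) ^ m = exp (- 4)"
    unfolding exp_of_nat_mult[symmetric] using x(4) by (simp add: algebra_simps)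
  also have "r ^ m \<le> r ^ (L ^ n - 1)"
    using x assms(3) by (intro power_decreasing) (auto simp: m_def)
  finally have "exp (- 4) \<le> r ^ (L ^ n - 1)" .
  moreover have "1 / 81 \<le> exp (- 4 :: real)"
  proof -
    have "exp (4::real) = exp 1 ^ 4"
      by (simp flip: exp_of_nat_mult)
    also have "\<dots> \<le> 3 ^ 4"
      by (intro power_mono exp_le) simp
    finally show ?thesis by (simp add: exp_minus field_simps)
  qed
  ultimately show ?thesis by linarith
qed

text \<open>Write M = b n * L^n. The leading part of block n is at least M / 162, from 1 / 81 for
  the power and 1 / 2 for \<open>Q\<close>. The derivative of \<open>Q\<close>, the head and the
  tail cost at most M / 5000, M / 2500 and 24 M / 10000, which leaves more than M / 400.\<close>

lemma deriv_limit_ge: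
  assumes "1 \<le> n" "1 - 2 / L ^ n \<le> norm z" "norm z \<le> 1 - 1 / L ^ n"
    and "start u v" "1 / 2 \<le> norm (Q u v n z)" "(\<lambda>n. of_real (b n) * block' u v n z) sums d"
  shows "b n * L ^ n / 400 \<le> norm d"
proof -
  let ?t = "\<lambda>n. of_real (b n) * block' u v n z"
  define M where "M = b n * L ^ n"
  have M: "0 < M"
    using b_pos[of n] L_ge(1) by (simp add: M_def)
  have "0 < 1 / real (L ^ n)"
    by (intro divide_pos_pos) (use L_ge(1) in auto)
  with assms(3) have z: "norm z < 1" "norm z \<le> 1"
    by linarith+
  have "d = (\<Sum>k. ?t (k + Suc n)) + ((\<Sum>i<n. ?t i) + ?t n)"
    using suminf_split_initial_segment[OF sums_summable[OF assms(6)], of "Suc n"] sums_unique[OF assms(6)]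
    by simp
  then have 1: "norm (?t n) - norm (\<Sum>i<n. ?t i) - norm (\<Sum>k. ?t (k + Suc n)) \<le> norm d"
    using norm_triangle_ineq[of "?t n + (\<Sum>i<n. ?t i)" "\<Sum>k. ?t (k + Suc n)"]
      norm_triangle_ineq4[of d "(\<Sum>k. ?t (k + Suc n)) + (\<Sum>i<n. ?t i)"]
      norm_triangle_ineq[of "\<Sum>k. ?t (k + Suc n)" "\<Sum>i<n. ?t i"]
    by (simp add: algebra_simps)
  have 2: "norm (\<Sum>k. ?t (k + Suc n)) \<le> 24 * C / L * M"
    using tail_sum(2)[OF assms(4,3)] by (simp add: M_def)
  have "norm (\<Sum>i<n. ?t i) \<le> (\<Sum>i<n. 2 * C * (b i * L ^ i))"
    using norm_block'_le[OF assms(4) z(2)] b_pos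
    by (intro sum_norm_le) (simp add: norm_mult less_imp_le mult.left_commute[of _ "b _"] mult.assoc[symmetric] mult_left_mono)
  also have "\<dots> \<le> 2 * C * (M * (K / (L - K)))"
    unfolding sum_distrib_left[symmetric] M_def using C_ge_1 by (intro mult_left_mono head_sum) auto
  finally have 3: "norm (\<Sum>i<n. ?t i) \<le> 2 * C * (K / (L - K)) * M"
    by (simp add: mult_ac)
  have 4: "M * (1 / 162 - C / (real L - 2)) \<le> norm (?t n)"
  proof -
    have "1 / 81 * (1 / 2) \<le> norm z ^ (L ^ n - 1) * norm (Q u v n z)"
      using power_near_circle[OF assms(1,2) z(1)] assms(5) by (intro mult_mono) auto
    then have "L ^ n * (1 / 162) \<le> L ^ n * (norm z ^ (L ^ n - 1) * norm (Q u v n z))"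
      by (intro mult_left_mono) auto
    also have "\<dots> = norm (of_nat (L ^ n) * z ^ (L ^ n - 1) * Q u v n z)"
      by (simp add: norm_mult norm_power)
    finally have a: "L ^ n * (1 / 162) \<le> norm (of_nat (L ^ n) * z ^ (L ^ n - 1) * Q u v n z)" .
    have "norm z ^ (L ^ n) * norm (deriv (Q u v n) z) \<le> 1 * (C * L ^ n / (real L - 2))"
      using z deriv_PQ_bound[OF assms(4) z(2), of n] by (intro mult_mono power_le_one) auto
    then have b: "norm (z ^ (L ^ n) * deriv (Q u v n) z) \<le> C * L ^ n / (real L - 2)"
      by (simp add: norm_mult norm_power)
    have "L ^ n * (1 / 162) - C * L ^ n / (real L - 2) \<le> norm (block' u v n z)"
      unfolding block'_def using norm_diff_ineq[of "of_nat (L ^ n) * z ^ (L ^ n - 1) * Q u v n z" "z ^ (L ^ n) * deriv (Q u v n) z"] a b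
      by linarith
    then have "b n * (L ^ n * (1 / 162) - C * L ^ n / (real L - 2)) \<le> b n * norm (block' u v n z)"
      using b_pos[of n] by (intro mult_left_mono) auto
    then show ?thesis
      using b_pos[of n] by (simp add: norm_mult M_def algebra_simps)
  qed
  have "C / (real L - 2) \<le> 1 / 5000" "24 * C / L \<le> 24 / 10000"
    using L_ge C_ge_1 by (auto simp: field_simps)
  moreover have "2 * C * (K / (L - K)) \<le> 1 / 2500"
  proof -
    have "2 * C * K * 2500 \<le> L - K"
      using L_large L_ge by linarith
    moreover have "0 < L - K" using L_ge K_ge_1 by linarith
    ultimately show ?thesis by (simp add: field_simps)
  qed
  ultimately have "1 / 400 \<le> 1 / 162 - C / (real L - 2) - 2 * C * (K / (L - K)) - 24 * C / L"
    by linarith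
  then have "M * (1 / 400) \<le> M * (1 / 162 - C / (real L - 2) - 2 * C * (K / (L - K)) - 24 * C / L)"
    using M by (intro mult_left_mono) auto
  also have "\<dots> = M * (1 / 162 - C / (real L - 2)) - 2 * C * (K / (L - K)) * M - 24 * C / L * M"
    by (simp only: right_diff_distrib mult.commute[of M])
  also have "\<dots> \<le> norm d"
    using 1 2 3 4 by linarith
  finally show ?thesis by (simp add: M_def)
qed

end

section \<open>Integral means of holomorphic functions over annuli\<close>

lemma lborel_complex_eq_distr:
  "(lborel :: complex measure) = distr (lborel \<Otimes>\<^sub>M lborel) borel (\<lambda>(x, y). Complex x y)"
proof (rule lborel_eqI)
  have m: "(\<lambda>(x, y). Complex x y) \<in> borel_measurable (lborel \<Otimes>\<^sub>M lborel)"
    unfolding Complex_eq by measurable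
  fix l u :: complex
  assume *: "\<And>b. b \<in> Basis \<Longrightarrow> l \<bullet> b \<le> u \<bullet> b"
  have le: "Re l \<le> Re u" "Im l \<le> Im u"
    using *[of 1] *[of \<i>] by (auto simp: Basis_complex_def)
  have "(\<lambda>(x, y). Complex x y) -` box l u \<inter> space (lborel \<Otimes>\<^sub>M lborel) = {Re l<..<Re u} \<times> {Im l<..<Im u}"
    by (auto simp: in_box_complex_iff space_pair_measure)
  then show "emeasure (distr (lborel \<Otimes>\<^sub>M lborel) borel (\<lambda>(x, y). Complex x y)) (box l u) = (\<Prod>b\<in>Basis. (u - l) \<bullet> b)"
    using le by (simp add: emeasure_distr m lborel.emeasure_pair_measure_Times Basis_complex_def ennreal_mult)
qed simp

lemma nn_integral_complex:
  assumes [measurable]: "f \<in> borel_measurable borel"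
  shows "(\<integral>\<^sup>+z. f z \<partial>lborel) = (\<integral>\<^sup>+y. \<integral>\<^sup>+x. f (Complex x y) \<partial>lborel \<partial>lborel)"
    and "(\<integral>\<^sup>+z. f z \<partial>lborel) = (\<integral>\<^sup>+x. \<integral>\<^sup>+y. f (Complex x y) \<partial>lborel \<partial>lborel)"
proof -
  have m[measurable]: "(\<lambda>(x, y). Complex x y) \<in> borel_measurable (lborel \<Otimes>\<^sub>M lborel)"
    unfolding Complex_eq by measurable
  have f: "(\<lambda>w. f (case w of (x, y) \<Rightarrow> Complex x y)) \<in> borel_measurable (lborel \<Otimes>\<^sub>M lborel)"
    by (rule measurable_compose[OF m assms])
  have *: "(\<integral>\<^sup>+z. f z \<partial>lborel) = (\<integral>\<^sup>+w. f (case w of (x, y) \<Rightarrow> Complex x y) \<partial>(lborel \<Otimes>\<^sub>M lborel))"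
    by (subst lborel_complex_eq_distr) (rule nn_integral_distr[OF m], simp)
  show "(\<integral>\<^sup>+z. f z \<partial>lborel) = (\<integral>\<^sup>+y. \<integral>\<^sup>+x. f (Complex x y) \<partial>lborel \<partial>lborel)"
    using lborel_pair.nn_integral_snd[OF f] * by simp
  show "(\<integral>\<^sup>+z. f z \<partial>lborel) = (\<integral>\<^sup>+x. \<integral>\<^sup>+y. f (Complex x y) \<partial>lborel \<partial>lborel)"
    using lborel.nn_integral_fst[OF f] * by simp
qed

text \<open>With the outer coordinate frozen, a shear is a translation of the inner one. The two
  kinds of shear therefore call for the two orders of integration.\<close>

lemma nn_integral_shear:
  assumes [measurable]: "f \<in> borel_measurable borel"
  shows "(\<integral>\<^sup>+z. f (Complex (Re z + t * Im z) (Im z)) \<partial>lborel) = (\<integral>\<^sup>+z. f z \<partial>lborel)"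
    and "(\<integral>\<^sup>+z. f (Complex (Re z) (Im z + t * Re z)) \<partial>lborel) = (\<integral>\<^sup>+z. f z \<partial>lborel)"
proof -
  have [measurable]: "(\<lambda>x. Complex (g x) (h x)) \<in> borel_measurable M"
    if [measurable]: "g \<in> borel_measurable M" "h \<in> borel_measurable M" for g h :: "'a \<Rightarrow> real" and M
    unfolding Complex_eq by measurable
  have [measurable]: "(\<lambda>x. Complex (g x) (h x)) \<in> borel_measurable M"
    if [measurable]: "g \<in> borel_measurable M" "h \<in> borel_measurable M" for g h :: "complex \<Rightarrow> real" and M
    unfolding Complex_eq by measurable
  have [measurable]: "(\<lambda>x. Complex (g x) (h x)) \<in> borel_measurable M"
    if [measurable]: "g \<in> borel_measurable M" "h \<in> borel_measurable M" for g h :: "real \<Rightarrow> real" and M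
    unfolding Complex_eq by measurable
  have tr: "(\<integral>\<^sup>+x. h (x + a) \<partial>lborel) = (\<integral>\<^sup>+x. h x \<partial>lborel)"
    if "h \<in> borel_measurable borel" for h :: "real \<Rightarrow> ennreal" and a
    using nn_integral_real_affine[OF that, of 1 a] by (simp add: add.commute)
  have "(\<integral>\<^sup>+z. f (Complex (Re z + t * Im z) (Im z)) \<partial>lborel)
      = (\<integral>\<^sup>+y. \<integral>\<^sup>+x. f (Complex (x + t * y) y) \<partial>lborel \<partial>lborel)"
    by (subst nn_integral_complex(1)) auto
  also have "\<dots> = (\<integral>\<^sup>+y. \<integral>\<^sup>+x. f (Complex x y) \<partial>lborel \<partial>lborel)"
    by (subst tr) auto
  finally show "(\<integral>\<^sup>+z. f (Complex (Re z + t * Im z) (Im z)) \<partial>lborel) = (\<integral>\<^sup>+z. f z \<partial>lborel)"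
    by (subst nn_integral_complex(1)) auto
  have "(\<integral>\<^sup>+z. f (Complex (Re z) (Im z + t * Re z)) \<partial>lborel)
      = (\<integral>\<^sup>+x. \<integral>\<^sup>+y. f (Complex x (y + t * x)) \<partial>lborel \<partial>lborel)"
    by (subst nn_integral_complex(2)) auto
  also have "\<dots> = (\<integral>\<^sup>+x. \<integral>\<^sup>+y. f (Complex x y) \<partial>lborel \<partial>lborel)"
    by (subst tr) auto
  finally show "(\<integral>\<^sup>+z. f (Complex (Re z) (Im z + t * Re z)) \<partial>lborel) = (\<integral>\<^sup>+z. f z \<partial>lborel)"
    by (subst nn_integral_complex(2)) auto
qed

text \<open>A rotation is a product of three shears, which preserve Lebesgue measure by Fubini.\<close>

lemma nn_integral_rotate:
  fixes f :: "complex \<Rightarrow> ennreal"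
  assumes [measurable]: "f \<in> borel_measurable borel" and c: "cos \<theta> \<noteq> 0"
  shows "(\<integral>\<^sup>+z. f (cis (2 * \<theta>) * z) \<partial>lborel) = (\<integral>\<^sup>+z. f z \<partial>lborel)"
proof -
  \<comment> \<open>Rotation by 2\<theta> is a horizontal shear by t, then a vertical one by s, then
    again a horizontal one by t. The identities \<open>cs\<close> compare the matrix entries; t is a
    tangent, whence the condition on cos \<theta>.\<close>
  define t s where "t = - tan \<theta>" and "s = sin (2 * \<theta>)"
  have cs: "cos (2 * \<theta>) = 1 + t * s" "- s = 2 * t + t * t * s"
  proof -
    have ts: "t * s = - 2 * (sin \<theta>)\<^sup>2"
      using c by (simp add: t_def s_def tan_def sin_double power2_eq_square)
    then show *: "cos (2 * \<theta>) = 1 + t * s"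
      by (simp add: cos_double_sin)
    have "t * t * s = t * (t * s)" by simp
    then have "2 * t + t * t * s = 2 * t * (1 - (sin \<theta>)\<^sup>2)"
      unfolding ts by (simp add: algebra_simps)
    also have "\<dots> = 2 * t * (cos \<theta>)\<^sup>2"
      by (simp add: cos_squared_eq)
    also have "\<dots> = - s"
      using c by (simp add: t_def s_def tan_def sin_double power2_eq_square)
    finally show "- s = 2 * t + t * t * s" by simp
  qed
  have [measurable]: "(\<lambda>x. Complex (g x) (h x)) \<in> borel_measurable M"
    if [measurable]: "g \<in> borel_measurable M" "h \<in> borel_measurable M" for g h :: "complex \<Rightarrow> real" and M
    unfolding Complex_eq by measurable
  define h1 where "h1 z = f (Complex (Re z + t * Im z) (Im z))" for z
  define h2 where "h2 z = h1 (Complex (Re z) (Im z + s * Re z))" for z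
  have m[measurable]: "h1 \<in> borel_measurable borel" "h2 \<in> borel_measurable borel"
    unfolding h1_def[abs_def] h2_def[abs_def] by measurable
  have "f (cis (2 * \<theta>) * z) = h2 (Complex (Re z + t * Im z) (Im z))" for z
  proof -
    have "cis (2 * \<theta>) * z = Complex (Re z + t * Im z + t * (Im z + s * (Re z + t * Im z))) (Im z + s * (Re z + t * Im z))"
    proof (rule complex_eqI)
      have "cos (2 * \<theta>) * x - s * y = x + t * y + t * (y + s * (x + t * y))" for x y
      proof -
        have "x + t * y + t * (y + s * (x + t * y)) = (1 + t * s) * x + (2 * t + t * t * s) * y"
          by (simp add: algebra_simps)
        then show ?thesis unfolding cs(1) cs(2)[symmetric] by simp
      qed
      then show "Re (cis (2 * \<theta>) * z) = Re (Complex (Re z + t * Im z + t * (Im z + s * (Re z + t * Im z))) (Im z + s * (Re z + t * Im z)))"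
        by (simp add: s_def)
      have "cos (2 * \<theta>) * y + s * x = y + s * (x + t * y)" for x y
        unfolding cs(1) by (simp add: algebra_simps)
      then show "Im (cis (2 * \<theta>) * z) = Im (Complex (Re z + t * Im z + t * (Im z + s * (Re z + t * Im z))) (Im z + s * (Re z + t * Im z)))"
        by (simp add: s_def)
    qed
    then show ?thesis by (simp add: h1_def h2_def)
  qed
  then have "(\<integral>\<^sup>+z. f (cis (2 * \<theta>) * z) \<partial>lborel) = (\<integral>\<^sup>+z. h2 z \<partial>lborel)"
    using nn_integral_shear(1)[OF m(2), of t] by simp
  also have "\<dots> = (\<integral>\<^sup>+z. h1 z \<partial>lborel)"
    unfolding h2_def by (rule nn_integral_shear(2)[OF m(1)])
  also have "\<dots> = (\<integral>\<^sup>+z. f z \<partial>lborel)"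
    unfolding h1_def by (rule nn_integral_shear(1)) simp
  finally show ?thesis .
qed

section \<open>Subharmonicity of powers of the modulus\<close>

text \<open>The parameter runs over [0, 1], which normalises the mean and matches the
  parametrisation of \<open>circlepath\<close>.\<close>

definition circle_mean :: "real \<Rightarrow> (complex \<Rightarrow> complex) \<Rightarrow> real \<Rightarrow> real" where
  "circle_mean q h R = integral {0..1} (\<lambda>t. norm (h (of_real R * cis (2 * pi * t))) powr q)"

lemma continuous_on_circle:
  assumes "h holomorphic_on ball 0 \<rho>" "0 < R" "R < \<rho>" "0 < q"
  shows "continuous_on UNIV (\<lambda>t. norm (h (of_real R * cis (2 * pi * t))) powr q)"
proof -
  have "continuous_on (ball 0 \<rho>) h"
    using assms(1) by (rule holomorphic_on_imp_continuous_on)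
  then have c: "continuous_on UNIV (\<lambda>t. h (of_real R * cis (2 * pi * t)))"
    by (rule continuous_on_compose2) (use assms(2,3) in \<open>auto intro!: continuous_intros simp: norm_mult\<close>)
  show ?thesis
    using assms(4) by (intro continuous_on_powr' continuous_intros c) auto
qed

lemma mean_value_circle:
  assumes "h holomorphic_on ball 0 \<rho>" "0 < R" "R < \<rho>"
  shows "((\<lambda>t. h (of_real R * cis (2 * pi * t))) has_integral h 0) {0..1}"
proof -
  have "h holomorphic_on cball 0 R"
    using assms by (intro holomorphic_on_subset[OF assms(1)]) auto
  then have "((\<lambda>u. h u / (u - 0)) has_contour_integral (2 * of_real pi * \<i> * h 0)) (circlepath 0 R)"
    using assms by (intro Cauchy_integral_circlepath_simple) auto
  then have "((\<lambda>t. h (circlepath 0 R t) / circlepath 0 R t * vector_derivative (circlepath 0 R) (at t within {0..1}))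
      has_integral (2 * of_real pi * \<i> * h 0)) {0..1}"
    by (simp add: has_contour_integral_def)
  then have "((\<lambda>t. 2 * of_real pi * \<i> * h (of_real R * cis (2 * pi * t))) has_integral (2 * of_real pi * \<i> * h 0)) {0..1}"
  proof (rule has_integral_eq[rotated])
    fix t :: real assume t: "t \<in> {0..1}"
    have e: "exp (2 * of_real pi * \<i> * of_real t) = cis (2 * pi * t)"
      by (simp add: cis_conv_exp mult_ac)
    show "h (circlepath 0 R t) / circlepath 0 R t * vector_derivative (circlepath 0 R) (at t within {0..1}) =
         2 * of_real pi * \<i> * h (of_real R * cis (2 * pi * t))"
    proof -
      have "vector_derivative (circlepath 0 R) (at t within {0..1}) = 2 * pi * \<i> * R * cis (2 * pi * t)"
        using t by (simp add: vector_derivative_circlepath01 e)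
      moreover have "circlepath 0 R t = of_real R * cis (2 * pi * t)"
        by (simp add: circlepath e)
      ultimately show ?thesis using assms(2) by simp
    qed
  qed
  note * = has_integral_mult_right[OF this, of "inverse (2 * of_real pi * \<i>)"]
  have "inverse (2 * of_real pi * \<i>) * (2 * of_real pi * \<i> * x) = x" for x
    by (subst mult.assoc[symmetric], subst left_inverse) auto
  with * show ?thesis by (simp only:)
qed

lemma circle_mean_nonneg: "0 \<le> circle_mean q h R"
  unfolding circle_mean_def
  by (cases "(\<lambda>t. norm (h (of_real R * cis (2 * pi * t))) powr q) integrable_on {0..1}")
     (auto intro: integral_nonneg simp: not_integrable_integral)

text \<open>A zero-free \<open>h\<close> has a holomorphic power \<open>exp (q * log h)\<close>, to which the mean value property applies.\<close>

lemma circle_mean_ge_zero_free: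
  assumes "h holomorphic_on ball 0 \<rho>" "0 < R" "R < \<rho>" "0 < q" "\<And>z. z \<in> ball 0 \<rho> \<Longrightarrow> h z \<noteq> 0"
  shows "norm (h 0) powr q \<le> circle_mean q h R"
proof -
  obtain l where l: "l holomorphic_on ball 0 \<rho>" "\<And>z. z \<in> ball 0 \<rho> \<Longrightarrow> h z = exp (l z)"
    using contractible_imp_holomorphic_log[OF assms(1) convex_imp_contractible[OF convex_ball] assms(5)] by blast
  define m where "m z = exp (of_real q * l z)" for z
  have m: "m holomorphic_on ball 0 \<rho>"
    unfolding m_def by (intro holomorphic_intros l)
  have nm: "norm (m z) = norm (h z) powr q" if "z \<in> ball 0 \<rho>" for z
    using l(2)[OF that] by (simp add: m_def powr_def mult.commute)
  have I: "((\<lambda>t. m (of_real R * cis (2 * pi * t))) has_integral m 0) {0..1}"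
    by (rule mean_value_circle[OF m assms(2,3)])
  have "norm (integral {0..1} (\<lambda>t. m (of_real R * cis (2 * pi * t)))) \<le> circle_mean q h R"
    unfolding circle_mean_def
  proof (rule integral_norm_bound_integral)
    show "(\<lambda>t. m (of_real R * cis (2 * pi * t))) integrable_on {0..1}"
      using I by blast
    show "(\<lambda>t. norm (h (of_real R * cis (2 * pi * t))) powr q) integrable_on {0..1}"
      using continuous_on_circle[OF assms(1-4)] continuous_on_subset by (intro integrable_continuous_interval) blast
    show "norm (m (of_real R * cis (2 * pi * t))) \<le> norm (h (of_real R * cis (2 * pi * t))) powr q" if "t \<in> {0..1}" for t
      using nm[of "of_real R * cis (2 * pi * t)"] assms by (simp add: norm_mult)
  qed
  then show ?thesis
    using nm[of 0] assms integral_unique[OF I] by simp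
qed

text \<open>The quotient by (z - a)^n is analytic across a because it agrees near a with the local
  zero-free factor; n = 0 covers a nonzero value at a. It is used for the zeros inside a circle and
  for a possible zero of the multiplier at the origin.\<close>

lemma holomorphic_factor_out_zero:
  assumes holf: "f holomorphic_on S" and S: "open S" "connected S" and "a \<in> S"
    and nonconst: "\<not> f constant_on S"
  obtains g n where "g holomorphic_on S" "g a \<noteq> 0" "\<And>z. z \<in> S \<Longrightarrow> f z = (z - a) ^ n * g z"
proof (cases "f a = 0")
  case False
  then show thesis
    using that[of f 0] holf by simp
next
  case True
  obtain g r n where g: "0 < r" "ball a r \<subseteq> S" "g holomorphic_on ball a r"
    "\<And>w. w \<in> ball a r \<Longrightarrow> f w = (w - a) ^ n * g w" "\<And>w. w \<in> ball a r \<Longrightarrow> g w \<noteq> 0"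
    using holomorphic_factor_zero_nonconstant[OF holf S \<open>a \<in> S\<close> True nonconst] by metis
  define k where "k z = (if z = a then g a else f z / (z - a) ^ n)" for z
  have eq: "k z = g z" if "z \<in> ball a r" for z
    using g(4)[OF that] by (auto simp: k_def)
  have "k holomorphic_on S - {a}"
    by (rule holomorphic_transform[of "\<lambda>z. f z / (z - a) ^ n"])
       (auto intro!: holomorphic_intros holomorphic_on_subset[OF holf] simp: k_def)
  moreover have "k holomorphic_on ball a r"
    using holomorphic_transform[OF g(3)] eq by metis
  ultimately have "k holomorphic_on (S - {a}) \<union> ball a r"
    using S by (intro holomorphic_on_Un) auto
  moreover have "(S - {a}) \<union> ball a r = S"
    using g(1,2) \<open>a \<in> S\<close> by auto
  ultimately have "k holomorphic_on S" by simp
  moreover have "k a \<noteq> 0"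
    using g(1,5) by (simp add: k_def)
  moreover have "f z = (z - a) ^ n * k z" if "z \<in> S" for z
    using g(4)[of a] g(1) True by (cases "z = a") (auto simp: k_def)
  ultimately show thesis by (rule that)
qed

text \<open>Zeros inside the circle are traded for Blaschke factors: this keeps the modulus on the circle and
  does not decrease it at the origin.\<close>

lemma circle_mean_ge:
  assumes "h holomorphic_on ball 0 \<rho>" "0 < R" "R < \<rho>" "0 < q" "\<And>z. norm z = R \<Longrightarrow> h z \<noteq> 0"
  shows "norm (h 0) powr q \<le> circle_mean q h R"
  using assms
proof (induction "card {z \<in> ball 0 R. h z = 0}" arbitrary: h rule: less_induct)
  case (less h)
  note h = less.prems
  have nonconst: "\<not> h constant_on ball 0 \<rho>" if "z \<in> ball 0 \<rho>" "h z = 0" for z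
  proof
    assume "h constant_on ball 0 \<rho>"
    then have "h (of_real R) = h z"
      using that(1) h(2,3) by (fastforce simp: constant_on_def)
    then show False
      using h(5)[of "of_real R"] h(2) that(2) by simp
  qed
  show ?case
  proof (cases "\<exists>a. a \<in> ball 0 R \<and> h a = 0")
    case False
    define U where "U = {z \<in> ball 0 \<rho>. h z \<noteq> 0}"
    have "open U"
    proof -
      have "U = ball 0 \<rho> \<inter> h -` (- {0})" by (auto simp: U_def)
      then show ?thesis
        using continuous_open_preimage[OF holomorphic_on_imp_continuous_on[OF h(1)] open_ball, of "- {0}"] by auto
    qed
    moreover have "cball 0 R \<subseteq> U"
    proof
      fix z :: complex assume "z \<in> cball 0 R"
      then consider "norm z < R" | "norm z = R" by fastforce
      then show "z \<in> U"
        using False h(3,5) by cases (auto simp: U_def)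
    qed
    \<comment> \<open>The zero-free case needs a logarithm on an open disc beyond the circle;
      compactness of the closed disc provides one of radius R + e.\<close>
    ultimately obtain e where e: "0 < e" "(\<Union>x\<in>cball 0 R. cball x e) \<subseteq> U"
      using compact_subset_open_imp_cball_epsilon_subset[OF compact_cball] by metis
    have sub: "ball 0 (R + e) \<subseteq> U"
    proof
      fix z :: complex assume z: "z \<in> ball 0 (R + e)"
      show "z \<in> U"
      proof (cases "norm z \<le> R")
        case True
        then show ?thesis using \<open>cball 0 R \<subseteq> U\<close> by auto
      next
        case False
        define x where "x = of_real (R / norm z) * z"
        have "norm x = R" using False h(2) by (auto simp: x_def norm_mult norm_divide)
        have "x - z = of_real (R / norm z - 1) * z"
          by (simp add: x_def left_diff_distrib)
        then have "norm (x - z) = \<bar>R / norm z - 1\<bar> * norm z"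
          by (simp only: norm_mult norm_of_real)
        also have "\<dots> = norm z - R"
        proof -
          have pos: "0 < norm z"
            using False h(2) by linarith
          have "R / norm z - 1 \<le> 0"
            using False pos by (simp add: divide_le_eq_1_pos)
          then have "\<bar>R / norm z - 1\<bar> * norm z = (1 - R / norm z) * norm z"
            by simp
          then show ?thesis
            unfolding left_diff_distrib using pos by simp
        qed
        finally have "z \<in> cball x e"
          using z by (simp add: dist_norm)
        then show ?thesis
          using subsetD[OF e(2), of z] UN_I[of x "cball 0 R" z "\<lambda>x. cball x e"] \<open>norm x = R\<close> by auto
      qed
    qed
    show ?thesis
    proof (rule circle_mean_ge_zero_free)
      show "h holomorphic_on ball 0 (R + e)"
        using sub by (intro holomorphic_on_subset[OF h(1)]) (auto simp: U_def)
    qed (use sub e h(2,4) in \<open>auto simp: U_def\<close>)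
  next
    case True
    then obtain a where a: "a \<in> ball 0 R" "h a = 0" by blast
    show ?thesis
    proof (cases "h 0 = 0")
      case True
      then show ?thesis using circle_mean_nonneg by simp
    next
      case h0: False
      have fin: "finite {z \<in> ball 0 R. h z = 0}"
        by (rule finite_subset[OF _ holomorphic_compact_finite_zeros[OF h(1) open_ball connected_ball, of "cball 0 R"]])
           (use nonconst[of a] a h(3) in auto)
      obtain g n where g: "g holomorphic_on ball 0 \<rho>" "g a \<noteq> 0" "\<And>z. z \<in> ball 0 \<rho> \<Longrightarrow> h z = (z - a) ^ n * g z"
        using holomorphic_factor_out_zero[OF h(1) open_ball connected_ball, of a] nonconst[of a] a h(3) by auto
      define k where "k z = ((of_real (R\<^sup>2) - cnj a * z) / of_real R) ^ n * g z" for z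
      \<comment> \<open>The new factor vanishes only at R^2 divided by the conjugate of a, which
        lies outside the disc. So k loses the zero a and gains none, and the induction
        applies.\<close>
      have k_zero: "h z = 0 \<and> z \<noteq> a" if z: "z \<in> ball 0 R" "k z = 0" for z
      proof -
        have "norm (cnj a * z) < R * R"
          using z a h(2) by (simp add: norm_mult mult_strict_mono)
        then have "of_real (R\<^sup>2) - cnj a * z \<noteq> 0"
          using norm_of_real[of "R\<^sup>2", where 'a = complex] by (auto simp: power2_eq_square)
        then have "g z = 0"
          using z h(2) by (auto simp: k_def)
        then show ?thesis using g(2,3) z(1) h(3) by auto
      qed
      \<comment> \<open>On |z| = R the number R^2 is z times its conjugate, so the numerator of the
        new factor is z times the conjugate of z - a.\<close>
      have same: "norm (k z) = norm (h z)" if "norm z = R" for z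
      proof -
        have "of_real (R\<^sup>2) - cnj a * z = z * cnj (z - a)"
          using complex_norm_square[of z] that by (simp add: algebra_simps)
        then have "norm ((of_real (R\<^sup>2) - cnj a * z) / of_real R) = norm (z - a)"
          using that h(2) by (simp add: norm_divide norm_mult del: complex_cnj_diff)
        then show ?thesis
          using g(3)[of z] that h(3) by (simp add: k_def norm_mult norm_power)
      qed
      have "norm (h 0) \<le> norm (k 0)"
      proof -
        have "norm (h 0) = norm a ^ n * norm (g 0)"
          using g(3)[of 0] h(2,3) by (simp add: norm_mult norm_power)
        also have "\<dots> \<le> R ^ n * norm (g 0)"
          using a by (intro mult_right_mono power_mono) auto
        also have "\<dots> = norm (k 0)"
          using h(2) by (simp add: k_def norm_mult norm_power norm_divide power2_eq_square)
        finally show ?thesis .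
      qed
      then have "norm (h 0) powr q \<le> norm (k 0) powr q"
        using h(4) by (intro powr_mono2) auto
      also have "\<dots> \<le> circle_mean q k R"
      proof (rule less.hyps)
        have "{z \<in> ball 0 R. k z = 0} \<subset> {z \<in> ball 0 R. h z = 0}"
          using k_zero a by blast
        then show "card {z \<in> ball 0 R. k z = 0} < card {z \<in> ball 0 R. h z = 0}"
          by (rule psubset_card_mono[OF fin])
        show "k holomorphic_on ball 0 \<rho>"
          unfolding k_def by (intro holomorphic_intros g) (use h(2) in auto)
        show "k z \<noteq> 0" if "norm z = R" for z
          using same[OF that] h(5)[OF that] by auto
      qed (use h in auto)
      also have "\<dots> = circle_mean q h R"
        unfolding circle_mean_def using same h(2) by (intro integral_cong) (simp add: norm_mult)
      finally show ?thesis .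
    qed
  qed
qed

text \<open>The shear factorisation fails when cos (\<alpha> / 2) = 0. Such a rotation is done in
  two halves: cos (\<alpha> / 4) = 0 would force cos (\<alpha> / 2) = -1.\<close>

lemma nn_integral_cis_mult:
  fixes f :: "complex \<Rightarrow> ennreal"
  assumes [measurable]: "f \<in> borel_measurable borel"
  shows "(\<integral>\<^sup>+z. f (cis \<alpha> * z) \<partial>lborel) = (\<integral>\<^sup>+z. f z \<partial>lborel)"
proof (cases "cos (\<alpha> / 2) = 0")
  case False
  then show ?thesis using nn_integral_rotate[OF assms, of "\<alpha> / 2"] by simp
next
  case True
  then have c: "cos (\<alpha> / 4) \<noteq> 0"
    using cos_double_cos[of "\<alpha> / 4"] by (auto simp: power2_eq_square)
  have "(\<lambda>z. f (cis (\<alpha> / 2) * z)) \<in> borel_measurable borel"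
    by measurable
  from nn_integral_rotate[OF this c] have "(\<integral>\<^sup>+z. f (cis (\<alpha> / 2) * (cis (\<alpha> / 2) * z)) \<partial>lborel)
      = (\<integral>\<^sup>+z. f (cis (\<alpha> / 2) * z) \<partial>lborel)"
    by simp
  also have "\<dots> = (\<integral>\<^sup>+z. f z \<partial>lborel)"
    using nn_integral_rotate[OF assms c] by simp
  finally show ?thesis
    by (simp add: mult.assoc[symmetric] cis_mult)
qed

text \<open>The mean over a circle is rewritten as a mean over the rotations of one of its points z.
  In this form it can be integrated over z and combined with rotation invariance.\<close>

lemma nn_integral_circle_ge:
  assumes h: "h holomorphic_on ball 0 1" and z: "0 < norm z" "norm z < 1" and q: "0 < q"
    and nz: "\<And>w. norm w = norm z \<Longrightarrow> h w \<noteq> 0"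
  shows "ennreal (norm (h 0) powr q) \<le> (\<integral>\<^sup>+t. ennreal (norm (h (cis (2 * pi * t) * z)) powr q) * indicator {0..1} t \<partial>lborel)"
proof -
  define c where "c = z / of_real (norm z)"
  have c: "norm c = 1" "of_real (norm z) * c = z" using z by (auto simp: c_def norm_divide)
  define k where "k w = h (c * w)" for w
  have k: "k holomorphic_on ball 0 1"
    unfolding k_def by (rule holomorphic_on_compose_gen[OF _ h, unfolded o_def])
      (auto intro!: holomorphic_intros simp: norm_mult c)
  have "norm (k 0) powr q \<le> circle_mean q k (norm z)"
    by (rule circle_mean_ge[OF k]) (use z q nz c in \<open>auto simp: k_def norm_mult\<close>)
  moreover have "((\<lambda>t. norm (k (of_real (norm z) * cis (2 * pi * t))) powr q) has_integral circle_mean q k (norm z)) {0..1}"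
    unfolding circle_mean_def
    using continuous_on_subset[OF continuous_on_circle[OF k z q] subset_UNIV]
    by (intro integrable_integral integrable_continuous_interval)
  then have "(\<integral>\<^sup>+t. ennreal (norm (k (of_real (norm z) * cis (2 * pi * t))) powr q) * indicator {0..1} t \<partial>lborel)
      = ennreal (circle_mean q k (norm z))"
    by (intro nn_integral_has_integral_lebesgue') auto
  moreover have "k (of_real (norm z) * cis (2 * pi * t)) = h (cis (2 * pi * t) * z)" for t
    unfolding k_def using c(2) by (metis mult.commute mult.left_commute)
  moreover have "k 0 = h 0" by (simp add: k_def)
  ultimately show ?thesis by (simp add: ennreal_leI)
qed

text \<open>Rotations replace polar coordinates: the integral over an annulus equals its average
  over all rotations, and Fubini brings the circle means inside. A zero of g at the origin, where
  the mean inequality would be void, is split off as z^k; 1 / 2 <= \<alpha> keeps |z|^k above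
  2^(-k).\<close>

lemma annulus_lower_bound:
  assumes g: "g holomorphic_on ball 0 1" and nonzero: "z0 \<in> ball 0 1" "g z0 \<noteq> 0" and q: "0 < q"
  obtains \<kappa> where "0 < \<kappa>"
    "\<And>\<alpha> \<beta>. 1 / 2 \<le> \<alpha> \<Longrightarrow> \<beta> < 1 \<Longrightarrow> ennreal \<kappa> * emeasure lborel {z::complex. \<alpha> \<le> norm z \<and> norm z \<le> \<beta>} \<le>
       (\<integral>\<^sup>+z. ennreal (norm (g z) powr q) * indicator {z. \<alpha> \<le> norm z \<and> norm z \<le> \<beta>} z \<partial>lborel)"
proof (cases "g constant_on ball 0 1")
  case True
  then have c: "g z = g z0" if "z \<in> ball 0 1" for z
    using that nonzero by (auto simp: constant_on_def)
  show thesis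
  proof (rule that[of "norm (g z0) powr q"])
    fix \<alpha> \<beta> :: real assume "1 / 2 \<le> \<alpha>" "\<beta> < 1"
    have A: "{z::complex. \<alpha> \<le> norm z \<and> norm z \<le> \<beta>} \<in> sets lborel"
      unfolding sets_lborel by measurable
    have "(\<integral>\<^sup>+z. ennreal (norm (g z) powr q) * indicator {z. \<alpha> \<le> norm z \<and> norm z \<le> \<beta>} z \<partial>lborel)
        = (\<integral>\<^sup>+z. ennreal (norm (g z0) powr q) * indicator {z::complex. \<alpha> \<le> norm z \<and> norm z \<le> \<beta>} z \<partial>lborel)"
      using c \<open>\<beta> < 1\<close> by (intro nn_integral_cong) (auto simp: indicator_def)
    also have "\<dots> = ennreal (norm (g z0) powr q) * emeasure lborel {z::complex. \<alpha> \<le> norm z \<and> norm z \<le> \<beta>}"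
      using A by (simp add: nn_integral_cmult)
    finally show "ennreal (norm (g z0) powr q) * emeasure lborel {z::complex. \<alpha> \<le> norm z \<and> norm z \<le> \<beta>}
        \<le> (\<integral>\<^sup>+z. ennreal (norm (g z) powr q) * indicator {z. \<alpha> \<le> norm z \<and> norm z \<le> \<beta>} z \<partial>lborel)"
      by simp
  qed (use nonzero in simp)
next
  case nonconst: False
  obtain h k where h: "h holomorphic_on ball 0 1" "h 0 \<noteq> 0" "\<And>z. z \<in> ball 0 1 \<Longrightarrow> g z = z ^ k * h z"
    using holomorphic_factor_out_zero[OF g open_ball connected_ball _ nonconst, of 0] by auto
  define \<kappa> where "\<kappa> = ((1 / 2) ^ k) powr q * norm (h 0) powr q"
  \<comment> \<open>The mean inequality is available only on circles free of zeros. The circles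
    through the zeros of g are countably many, so together they form a null set.\<close>
  define N where "N = (\<Union>a\<in>{z \<in> ball 0 1. g z = 0}. sphere (0::complex) (norm a))"
  have "countable {z \<in> ball 0 1. g z = 0}"
  proof (rule countable_subset)
    show "{z \<in> ball 0 1. g z = 0} \<subseteq> (\<Union>n. {z \<in> cball 0 (1 - 1 / real (Suc n)). g z = 0})"
    proof
      fix z :: complex assume z: "z \<in> {z \<in> ball 0 1. g z = 0}"
      then obtain n where "inverse (real (Suc n)) < 1 - norm z"
        using reals_Archimedean[of "1 - norm z"] by auto
      then show "z \<in> (\<Union>n. {z \<in> cball 0 (1 - 1 / real (Suc n)). g z = 0})"
        using z by (auto simp: inverse_eq_divide intro!: exI[of _ n])
    qed
    have sub: "cball (0::complex) (1 - 1 / real (Suc n)) \<subseteq> ball 0 1" for n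
    proof
      fix z :: complex assume "z \<in> cball 0 (1 - 1 / real (Suc n))"
      then have "norm z \<le> 1 - 1 / real (Suc n)" by simp
      moreover have "0 < 1 / real (Suc n)" by simp
      ultimately have "norm z < 1" by linarith
      then show "z \<in> ball 0 1" by simp
    qed
    show "countable (\<Union>n. {z \<in> cball 0 (1 - 1 / real (Suc n)). g z = 0})"
      by (intro countable_UN countableI_type countable_finite
            holomorphic_compact_finite_zeros[OF g open_ball connected_ball compact_cball sub nonconst])
  qed
  then have N: "N \<in> null_sets lebesgue"
    unfolding N_def using negligible_sphere by (intro null_sets_UN') (auto simp: negligible_iff_null_sets)
  then have AE: "AE z in lborel. z \<notin> N"
    using AE_not_in AE_completion_iff by blast
  show thesis
  proof (rule that[of \<kappa>])
    show "0 < \<kappa>" using h(2) by (simp add: \<kappa>_def)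
    fix \<alpha> \<beta> :: real assume ab: "1 / 2 \<le> \<alpha>" "\<beta> < 1"
    define A where "A = {z::complex. \<alpha> \<le> norm z \<and> norm z \<le> \<beta>}"
    have A[measurable]: "A \<in> sets borel"
      unfolding A_def by measurable
    define \<phi> where "\<phi> z = ennreal (norm (g z) powr q) * indicator A z" for z
    have cg: "continuous_on A g"
      by (rule continuous_on_subset[OF holomorphic_on_imp_continuous_on[OF g]]) (use ab in \<open>auto simp: A_def\<close>)
    have contA: "continuous_on A (\<lambda>z. norm (g z) powr q)"
      by (intro continuous_on_powr' continuous_on_norm cg continuous_on_const) (use q in auto)
    have "(\<lambda>z. indicator A z *\<^sub>R (norm (g z) powr q)) \<in> borel_measurable borel"
      by (intro borel_measurable_continuous_on_indicator contA A)
    then have "(\<lambda>z. ennreal (indicator A z *\<^sub>R (norm (g z) powr q))) \<in> borel_measurable borel"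
      by measurable
    moreover have "\<phi> = (\<lambda>z. ennreal (indicator A z *\<^sub>R (norm (g z) powr q)))"
      by (auto simp: fun_eq_iff \<phi>_def indicator_def)
    ultimately have \<phi>[measurable]: "\<phi> \<in> borel_measurable borel"
      by simp
    have ge: "ennreal \<kappa> * indicator A z \<le> (\<integral>\<^sup>+t. \<phi> (cis (2 * pi * t) * z) * indicator {0..1} t \<partial>lborel)" if "z \<notin> N" for z
    proof (cases "z \<in> A")
      case True
      then have z: "1 / 2 \<le> norm z" "norm z < 1" using ab by (auto simp: A_def)
      have "h w \<noteq> 0" if "norm w = norm z" for w
        using h(3)[of w] that z \<open>z \<notin> N\<close> by (auto simp: N_def)
      then have "ennreal (norm (h 0) powr q) \<le> (\<integral>\<^sup>+t. ennreal (norm (h (cis (2 * pi * t) * z)) powr q) * indicator {0..1} t \<partial>lborel)"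
        using z q h(1) by (intro nn_integral_circle_ge) auto
      then have "ennreal (((1 / 2) ^ k) powr q) * ennreal (norm (h 0) powr q)
        \<le> ennreal (((1 / 2) ^ k) powr q) * (\<integral>\<^sup>+t. ennreal (norm (h (cis (2 * pi * t) * z)) powr q) * indicator {0..1} t \<partial>lborel)"
        by (rule mult_left_mono) simp
      also have "\<dots> \<le> (\<integral>\<^sup>+t. ennreal (((1 / 2) ^ k) powr q) * (ennreal (norm (h (cis (2 * pi * t) * z)) powr q) * indicator {0..1} t) \<partial>lborel)"
      proof (subst nn_integral_cmult)
        have "continuous_on UNIV (\<lambda>t. h (cis (2 * pi * t) * z))"
          by (rule continuous_on_compose2[OF holomorphic_on_imp_continuous_on[OF h(1)]])
             (use z in \<open>auto intro!: continuous_intros simp: norm_mult\<close>)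
        then have [measurable]: "(\<lambda>t. h (cis (2 * pi * t) * z)) \<in> borel_measurable borel"
          by (rule borel_measurable_continuous_onI)
        show "(\<lambda>t. ennreal (norm (h (cis (2 * pi * t) * z)) powr q) * indicator {0..1} t) \<in> borel_measurable lborel"
          by measurable
      qed simp
      also have "\<dots> \<le> (\<integral>\<^sup>+t. \<phi> (cis (2 * pi * t) * z) * indicator {0..1} t \<partial>lborel)"
      proof (intro nn_integral_mono)
        fix t
        have "((1 / 2) ^ k) powr q * norm (h (cis (2 * pi * t) * z)) powr q
            = ((1 / 2) ^ k * norm (h (cis (2 * pi * t) * z))) powr q"
          by (simp add: powr_mult)
        also have "\<dots> \<le> (norm z ^ k * norm (h (cis (2 * pi * t) * z))) powr q"
          using z q by (intro powr_mono2 mult_right_mono power_mono) auto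
        also have "\<dots> = norm (g (cis (2 * pi * t) * z)) powr q"
          using z by (subst h(3)) (auto simp: norm_mult norm_power)
        finally have *: "ennreal (((1 / 2) ^ k) powr q) * ennreal (norm (h (cis (2 * pi * t) * z)) powr q) \<le> ennreal (norm (g (cis (2 * pi * t) * z)) powr q)"
          by (simp add: ennreal_mult[symmetric] ennreal_leI)
        have "cis (2 * pi * t) * z \<in> A"
          using True by (simp add: A_def norm_mult)
        then show "ennreal (((1 / 2) ^ k) powr q) * (ennreal (norm (h (cis (2 * pi * t) * z)) powr q) * indicator {0..1} t)
            \<le> \<phi> (cis (2 * pi * t) * z) * indicator {0..1} t"
          unfolding \<phi>_def mult.assoc[symmetric] using * by (auto simp: indicator_def)
      qed
      finally show ?thesis
        using True by (simp add: \<kappa>_def ennreal_mult)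
    qed simp
    have "ennreal \<kappa> * emeasure lborel A = (\<integral>\<^sup>+z. ennreal \<kappa> * indicator A z \<partial>lborel)"
      by (simp add: nn_integral_cmult)
    also have "\<dots> \<le> (\<integral>\<^sup>+z. \<integral>\<^sup>+t. \<phi> (cis (2 * pi * t) * z) * indicator {0..1} t \<partial>lborel \<partial>lborel)"
      using AE ge by (intro nn_integral_mono_AE) auto
    also have "\<dots> = (\<integral>\<^sup>+t. \<integral>\<^sup>+z. \<phi> (cis (2 * pi * t) * z) * indicator {0..1} t \<partial>lborel \<partial>lborel)"
    proof (rule lborel_pair.Fubini'[symmetric])
      have "(\<lambda>x. cis (2 * pi * snd x) * fst x) \<in> borel_measurable (borel :: (complex \<times> real) measure)"
        by (intro borel_measurable_continuous_onI continuous_intros)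
      then have [measurable]: "(\<lambda>x. cis (2 * pi * snd x) * fst x) \<in> borel_measurable (lborel \<Otimes>\<^sub>M lborel :: (complex \<times> real) measure)"
        by (simp add: lborel_prod)
      show "(\<lambda>(z, t). \<phi> (cis (2 * pi * t) * z) * indicator {0..1} t) \<in> borel_measurable (lborel \<Otimes>\<^sub>M lborel)"
        unfolding split_beta' by measurable
    qed
    also have "\<dots> = (\<integral>\<^sup>+t. (\<integral>\<^sup>+z. \<phi> z \<partial>lborel) * indicator {0..1::real} t \<partial>lborel)"
      by (simp add: nn_integral_multc nn_integral_cis_mult)
    also have "\<dots> = (\<integral>\<^sup>+z. \<phi> z \<partial>lborel)"
      by (simp add: nn_integral_cmult)
    finally show "ennreal \<kappa> * emeasure lborel {z::complex. \<alpha> \<le> norm z \<and> norm z \<le> \<beta>} \<le>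
       (\<integral>\<^sup>+z. ennreal (norm (g z) powr q) * indicator {z. \<alpha> \<le> norm z \<and> norm z \<le> \<beta>} z \<partial>lborel)"
      unfolding \<phi>_def A_def .
  qed
qed

section \<open>Bounded functions are in BMOA\<close>

text \<open>Where a radial limit fails to exist, \<open>Lim\<close> is the unspecified constant \<open>THE l. False\<close>. Hence no theorem
  on the existence of radial limits is needed, only that the boundary function is measurable; the
  Cauchy criterion over rational radii shows that.\<close>

lemma Lim_at_left_eq_lim:
  fixes g :: "real \<Rightarrow> complex"
  assumes "continuous_on {0..<1} g"
  shows "Lim (at_left 1) g =
    (if \<forall>k::nat. \<exists>n::nat. \<forall>r s::rat. 1 - 1 / real (Suc n) < of_rat r \<and> of_rat r < (1::real) \<and>
          1 - 1 / real (Suc n) < of_rat s \<and> of_rat s < (1::real)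
          \<longrightarrow> dist (g (of_rat r)) (g (of_rat s)) \<le> 1 / real (Suc k)
     then lim (\<lambda>n. g (1 - 1 / real (Suc (Suc n)))) else (THE l. False))"
    (is "_ = (if \<forall>k. \<exists>n. ?C n k then _ else _)")
proof (cases "\<exists>l. (g \<longlongrightarrow> l) (at_left 1)")
  case True
  then obtain l where l: "(g \<longlongrightarrow> l) (at_left 1)" by blast
  have C: "\<exists>n. ?C n k" for k
  proof -
    define e where "e = 1 / real (Suc k)"
    have "\<forall>\<^sub>F r in at_left 1. dist (g r) l < e / 2"
      using l by (rule tendstoD) (simp add: e_def)
    then obtain b where b: "b < 1" "\<And>y. b < y \<Longrightarrow> y < 1 \<Longrightarrow> dist (g y) l < e / 2"
      using eventually_at_left[of 0 "1::real"] by auto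
    obtain n where n: "inverse (real (Suc n)) < 1 - b"
      using reals_Archimedean[of "1 - b"] b by auto
    have "dist (g x) (g y) \<le> 1 / real (Suc k)"
      if "1 - 1 / real (Suc n) < x" "x < 1" "1 - 1 / real (Suc n) < y" "y < 1" for x y
    proof -
      have "b < x" "b < y"
        using n that by (simp_all add: inverse_eq_divide)
      then have "dist (g x) l < e / 2" "dist (g y) l < e / 2"
        using b(2) that by auto
      then show ?thesis
        using dist_triangle2[of "g x" "g y" l] unfolding e_def[symmetric] by linarith
    qed
    then show ?thesis by blast
  qed
  have "filterlim (\<lambda>n. 1 - 1 / real (Suc (Suc n))) (at_left 1) sequentially"
    by real_asymp
  from filterlim_compose[OF l this] have "lim (\<lambda>n. g (1 - 1 / real (Suc (Suc n)))) = l"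
    by (rule limI)
  moreover have "Lim (at_left 1) g = l"
    by (rule tendsto_Lim[OF _ l]) simp
  ultimately show ?thesis using C by simp
next
  case False
  have "\<not> (\<forall>k. \<exists>n. ?C n k)"
  proof
    assume C: "\<forall>k. \<exists>n. ?C n k"
    \<comment> \<open>These radii are rational, so the Cauchy criterion applies to them; the shift
      by two puts \<open>x n\<close> strictly beyond 1 - 1 / (n + 1), as its strict inequalities
      demand.\<close>
    define x where "x n = (1 - 1 / real (Suc (Suc n)))" for n
    have xr: "x n = of_rat (1 - 1 / of_nat (Suc (Suc n)))" for n
      by (simp add: x_def of_rat_diff of_rat_divide of_rat_add)
    have x1: "x n < 1" "m \<le> n \<Longrightarrow> 1 - 1 / real (Suc m) < x n" for m n
      by (auto simp: x_def intro!: divide_strict_left_mono)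
    have "Cauchy (\<lambda>n. g (x n))"
    proof (rule metric_CauchyI)
      fix e :: real assume "0 < e"
      then obtain k where k: "inverse (real (Suc k)) < e"
        using reals_Archimedean by blast
      obtain N where N: "?C N k" using C by blast
      have "dist (g (x m)) (g (x n)) < e" if "N \<le> m" "N \<le> n" for m n
        using N[rule_format, of "1 - 1 / of_nat (Suc (Suc m))" "1 - 1 / of_nat (Suc (Suc n))"] x1 that k
        unfolding xr[symmetric] by (force simp: inverse_eq_divide)
      then show "\<exists>M. \<forall>m\<ge>M. \<forall>n\<ge>M. dist (g (x m)) (g (x n)) < e" by blast
    qed
    then obtain l where l: "(\<lambda>n. g (x n)) \<longlonglongrightarrow> l"
      using Cauchy_convergent convergent_def by blast
    have "(g \<longlongrightarrow> l) (at_left 1)"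
    proof (rule tendstoI)
      fix e :: real assume "0 < e"
      then obtain k where k: "inverse (real (Suc k)) < e / 2"
        using reals_Archimedean[of "e / 2"] by auto
      obtain N where N: "?C N k" using C by blast
      have rat: "dist (g (of_rat r)) l < e / 2" if "1 - 1 / real (Suc N) < of_rat r" "of_rat r < (1::real)" for r
      proof -
        have "(\<lambda>n. dist (g (of_rat r)) (g (x n))) \<longlonglongrightarrow> dist (g (of_rat r)) l"
          by (intro tendsto_intros l)
        moreover have "dist (g (of_rat r)) (g (x n)) \<le> 1 / real (Suc k)" if "N \<le> n" for n
          using N[rule_format, of r "1 - 1 / of_nat (Suc (Suc n))"] x1 that \<open>_ < of_rat r\<close> \<open>of_rat r < 1\<close>
          unfolding xr[symmetric] by blast
        ultimately have "dist (g (of_rat r)) l \<le> 1 / real (Suc k)"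
          by (intro Lim_bounded[of _ _ N]) auto
        then show ?thesis using k by (simp add: inverse_eq_divide)
      qed
      have "dist (g y) l < e" if y: "1 - 1 / real (Suc N) < y" "y < 1" for y
      proof -
        have "0 \<le> 1 - 1 / real (Suc N)" by simp
        then have "0 < y" using y by linarith
        then have y0: "y \<in> {0<..<1}" using y by simp
        have "continuous_on {0<..<1} g"
          by (rule continuous_on_subset[OF assms]) auto
        then have "isCont g y"
          using y0 by (simp add: continuous_on_eq_continuous_at)
        then obtain d where d: "0 < d" "\<And>z. dist z y < d \<Longrightarrow> dist (g z) (g y) < e / 2"
          unfolding continuous_at_eps_delta using \<open>0 < e\<close> by (metis half_gt_zero)
        \<comment> \<open>The criterion speaks of rational radii only; continuity carries the
          estimate over to the real radius y.\<close>
        obtain r where r: "y < of_rat r" "of_rat r < min 1 (y + d)"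
          using of_rat_dense[of y "min 1 (y + d)"] y d by auto
        have "dist (g (of_rat r)) (g y) < e / 2"
          using r by (intro d) (simp add: dist_real_def)
        moreover have "dist (g (of_rat r)) l < e / 2"
          using r y by (intro rat) auto
        ultimately show ?thesis
          using dist_triangle3[of "g y" l "g (of_rat r)"] by linarith
      qed
      moreover have "1 - 1 / real (Suc N) < 1" by simp
      ultimately show "\<forall>\<^sub>F y in at_left 1. dist (g y) l < e"
        using eventually_at_left[of 0 "1::real" "\<lambda>y. dist (g y) l < e"]
        by (auto simp del: of_nat_Suc intro!: exI[of _ "1 - 1 / real (Suc N)"])
    qed
    then show False using False by blast
  qed
  moreover have "Lim (at_left 1) g = (THE l. False)"
    using False by (simp add: Topological_Spaces.Lim_def)
  ultimately show ?thesis by (simp only: if_False)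
qed

lemma boundary_fun_measurable:
  assumes "f holomorphic_on ball 0 1"
  shows "boundary_fun f \<in> borel_measurable borel"
proof -
  have cont: "continuous_on (ball 0 1) f"
    using assms by (rule holomorphic_on_imp_continuous_on)
  \<comment> \<open>The quantifiers of the Cauchy criterion range formally over all rationals, so
    \<open>H r\<close> has to be measurable for radii outside [0, 1) as well; the cut-off takes care
    of that.\<close>
  define H where "H r \<theta> = (if 0 \<le> r \<and> r < 1 then f (of_real r * cis \<theta>) else 0)" for r \<theta>
  have H[measurable]: "H r \<in> borel_measurable borel" for r
  proof (cases "0 \<le> r \<and> r < 1")
    case True
    have "continuous_on UNIV (\<lambda>\<theta>. f (of_real r * cis \<theta>))"
      by (rule continuous_on_compose2[OF cont]) (use True in \<open>auto intro!: continuous_intros simp: norm_mult\<close>)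
    then show ?thesis
      using True by (simp add: H_def[abs_def] borel_measurable_continuous_onI)
  qed (auto simp: H_def[abs_def])
  have "boundary_fun f \<theta> = (if \<forall>k::nat. \<exists>n::nat. \<forall>r s::rat. 1 - 1 / real (Suc n) < of_rat r \<and> of_rat r < (1::real) \<and>
          1 - 1 / real (Suc n) < of_rat s \<and> of_rat s < (1::real)
          \<longrightarrow> dist (H (of_rat r) \<theta>) (H (of_rat s) \<theta>) \<le> 1 / real (Suc k)
     then lim (\<lambda>n. H (1 - 1 / real (Suc (Suc n))) \<theta>) else (THE l. False))" for \<theta>
  proof -
    have "continuous_on {0..<1} (\<lambda>r. f (of_real r * cis \<theta>))"
      by (rule continuous_on_compose2[OF cont]) (auto intro!: continuous_intros simp: norm_mult)
    then have c: "continuous_on {0..<1} (\<lambda>r. H r \<theta>)"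
      by (rule continuous_on_eq) (auto simp: H_def)
    have "((\<lambda>r. f (of_real r * cis \<theta>)) \<longlongrightarrow> l) (at_left 1) \<longleftrightarrow> ((\<lambda>r. H r \<theta>) \<longlongrightarrow> l) (at_left 1)" for l
    proof (rule tendsto_cong)
      show "\<forall>\<^sub>F r in at_left 1. f (of_real r * cis \<theta>) = H r \<theta>"
        using eventually_at_left[of 0 "1::real"] by (auto simp: H_def intro!: exI[of _ 0])
    qed
    then have "boundary_fun f \<theta> = Lim (at_left 1) (\<lambda>r. H r \<theta>)"
      by (simp add: boundary_fun_def Topological_Spaces.Lim_def)
    then show ?thesis using Lim_at_left_eq_lim[OF c] by simp
  qed
  then show ?thesis by (subst measurable_cong) measurable
qed

text \<open>The second argument of \<open>max\<close> is the default value taken at the angles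
  without a radial limit.\<close>

lemma norm_boundary_fun_le:
  assumes "\<And>z. z \<in> ball 0 1 \<Longrightarrow> norm (f z) \<le> B"
  shows "norm (boundary_fun f \<theta>) \<le> max B (norm (THE l::complex. False))"
proof (cases "\<exists>l. ((\<lambda>r. f (of_real r * cis \<theta>)) \<longlongrightarrow> l) (at_left 1)")
  case True
  then obtain l where l: "((\<lambda>r. f (of_real r * cis \<theta>)) \<longlongrightarrow> l) (at_left 1)" by blast
  then have "boundary_fun f \<theta> = l"
    unfolding boundary_fun_def by (intro tendsto_Lim) auto
  moreover have "\<forall>\<^sub>F r in at_left 1. norm (f (of_real r * cis \<theta>)) \<le> B"
    using eventually_at_left[of 0 "1::real"] assms by (auto simp: norm_mult intro!: exI[of _ 0])
  then have "norm l \<le> B"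
    by (rule tendsto_upperbound[OF tendsto_norm[OF l]]) simp
  ultimately show ?thesis by simp
next
  case False
  then have "boundary_fun f \<theta> = (THE l. False)"
    by (simp add: boundary_fun_def Topological_Spaces.Lim_def)
  then show ?thesis by simp
qed

lemma norm_set_integral_le:
  fixes g :: "real \<Rightarrow> 'b::{banach, second_countable_topology}"
  assumes [measurable]: "g \<in> borel_measurable borel" and D: "\<And>x. norm (g x) \<le> D" and "a \<le> b"
  shows "set_integrable lborel {a..b} g" "norm (LINT x:{a..b}|lborel. g x) \<le> D * (b - a)"
proof -
  show int: "set_integrable lborel {a..b} g"
    unfolding set_integrable_def
    by (rule integrableI_bounded_set_indicator[where B = D]) (use D \<open>a \<le> b\<close> in auto)
  have "norm (LINT x:{a..b}|lborel. g x) \<le> (LINT x:{a..b}|lborel. norm (g x))"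
    by (rule set_integral_norm_bound[OF int])
  also have "\<dots> \<le> (LINT x:{a..b}|lborel. D)"
  proof (rule set_integral_mono)
    show "set_integrable lborel {a..b} (\<lambda>x. norm (g x))"
      by (rule set_integrable_norm[OF int])
    show "set_integrable lborel {a..b} (\<lambda>x. D)"
      unfolding set_integrable_def
      by (rule integrableI_bounded_set_indicator[where B = "\<bar>D\<bar>"]) (use \<open>a \<le> b\<close> in auto)
  qed (rule D)
  also have "\<dots> = D * (b - a)"
    using \<open>a \<le> b\<close> by (simp add: set_lebesgue_integral_def)
  finally show "norm (LINT x:{a..b}|lborel. g x) \<le> D * (b - a)" .
qed

text \<open>A function bounded by M differs from each of its means by at most 2 M, which bounds the
  mean oscillation over every arc.\<close>

lemma bounded_holomorphic_in_BMOA: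
  assumes f: "f holomorphic_on ball 0 1" and B: "\<And>z. z \<in> ball 0 1 \<Longrightarrow> norm (f z) \<le> B"
  shows "f \<in> BMOA"
proof -
  have "integral {0..2*pi} (\<lambda>\<theta>. norm (f (of_real r * cis \<theta>))) / (2*pi) \<le> B" if r: "0 < r" "r < 1" for r
  proof -
    have "continuous_on {0..2*pi} (\<lambda>\<theta>. f (of_real r * cis \<theta>))"
      by (rule continuous_on_compose2[OF holomorphic_on_imp_continuous_on[OF f]])
         (use r in \<open>auto intro!: continuous_intros simp: norm_mult\<close>)
    then have "integral {0..2*pi} (\<lambda>\<theta>. norm (f (of_real r * cis \<theta>))) \<le> integral {0..2*pi} (\<lambda>\<theta>. B)"
      using r by (intro integral_le integrable_continuous_interval continuous_intros) (auto intro!: B simp: norm_mult)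
    then show ?thesis by (simp add: field_simps)
  qed
  then have 1: "f \<in> hardy1"
    using f by (auto simp: hardy1_def)
  define M where "M = max B (norm (THE l::complex. False))"
  define u where "u = boundary_fun f"
  have u[measurable]: "u \<in> borel_measurable borel"
    unfolding u_def by (rule boundary_fun_measurable[OF f])
  have uM: "norm (u \<theta>) \<le> M" for \<theta>
    unfolding u_def M_def by (rule norm_boundary_fun_le[OF B])
  have "bmo_circle u"
    unfolding bmo_circle_def
  proof (intro conjI allI impI exI[of _ "2 * M"])
    fix a b :: real assume "a < b"
    then show "set_integrable lborel {a..b} u"
      using norm_set_integral_le[OF u uM] by simp
  next
    fix a b :: real assume ab: "a < b \<and> b - a \<le> 2 * pi"
    define m where "m = (LINT t:{a..b}|lborel. u t) / complex_of_real (b - a)"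
    have "norm m \<le> M"
      using norm_set_integral_le(2)[OF u uM, of a b] ab by (simp add: m_def norm_divide divide_le_eq del: of_real_diff)
    have "norm (norm (u \<theta> - m)) \<le> 2 * M" for \<theta>
      using norm_triangle_ineq4[of "u \<theta>" m] uM[of \<theta>] \<open>norm m \<le> M\<close> by simp
    then have "norm (LINT \<theta>:{a..b}|lborel. norm (u \<theta> - m)) \<le> 2 * M * (b - a)"
      using ab by (intro norm_set_integral_le(2)) auto
    then show "(LINT \<theta>:{a..b}|lborel. norm (u \<theta> - m)) / (b - a) \<le> 2 * M"
      using ab by (simp add: divide_le_eq)
  qed
  with 1 show ?thesis by (simp add: BMOA_def u_def)
qed

section \<open>Weighted area integrals\<close>

lemma emeasure_annulus:
  assumes "0 \<le> \<alpha>" "\<alpha> \<le> \<beta>"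
  shows "emeasure lborel {z::complex. \<alpha> \<le> norm z \<and> norm z \<le> \<beta>} = ennreal (pi * (\<beta>\<^sup>2 - \<alpha>\<^sup>2))"
proof -
  have "{z::complex. \<alpha> \<le> norm z \<and> norm z \<le> \<beta>} = cball 0 \<beta> - ball 0 \<alpha>"
    by auto
  moreover have "emeasure lborel (cball (0::complex) \<beta> - ball 0 \<alpha>) = emeasure lborel (cball (0::complex) \<beta>) - emeasure lborel (ball (0::complex) \<alpha>)"
    using assms emeasure_ball[of \<alpha> "0::complex"] by (intro emeasure_Diff) auto
  ultimately show ?thesis
    using assms emeasure_ball[of \<alpha> "0::complex"] emeasure_cball[of \<beta> "0::complex"]
    by (simp add: unit_ball_vol_2 power2_eq_square ennreal_minus algebra_simps flip: power_mult_distrib)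
qed

text \<open>A function analytic in the disc is arbitrary elsewhere, possibly not measurable; the
  indicator removes those values.\<close>

lemma borel_measurable_ball_restrict:
  fixes f :: "complex \<Rightarrow> real"
  assumes f: "continuous_on (ball 0 1) f" and A: "A \<in> sets borel" "A \<subseteq> ball 0 1"
  shows "(\<lambda>z. ennreal (f z) * indicator A z) \<in> borel_measurable borel"
proof -
  have "(\<lambda>z. indicator A z *\<^sub>R f z) \<in> borel_measurable borel"
    by (intro borel_measurable_continuous_on_indicator A continuous_on_subset[OF f])
  then have "(\<lambda>z. ennreal (indicator A z *\<^sub>R f z)) \<in> borel_measurable borel"
    by measurable
  moreover have "(\<lambda>z. ennreal (indicator A z *\<^sub>R f z)) = (\<lambda>z. ennreal (f z) * indicator A z)"
    by (auto simp: indicator_def fun_eq_iff)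
  ultimately show ?thesis by simp
qed

text \<open>Meant for y = (1 - |z|) L^n and s = p - 1, which may have either sign; the absolute
  value serves both.\<close>

lemma powr_le_on_unit:
  fixes y l s :: real
  assumes "1 / l \<le> y" "y \<le> 1" "1 \<le> l"
  shows "y powr s \<le> l powr \<bar>s\<bar>"
proof (cases "0 \<le> s")
  case True
  have "0 < y" using assms by (smt (verit) divide_pos_pos)
  then have "y powr s \<le> 1 powr s"
    using True assms by (intro powr_mono2) auto
  also have "1 powr s \<le> l powr \<bar>s\<bar>"
    using assms by (simp add: ge_one_powr_ge_zero)
  finally show ?thesis .
next
  case False
  have "y powr s \<le> (1 / l) powr s"
    using False assms by (intro powr_mono2') auto
  also have "\<dots> = l powr \<bar>s\<bar>"
    using False assms by (simp add: powr_divide powr_minus_divide)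
  finally show ?thesis .
qed

text \<open>Meant for y = (1 - |z|) L^(n + 1) and s = q - 1 > -1. The value 1 / 2 is the worst case
  y = 2, s = -1.\<close>

lemma powr_ge_on_doubling:
  fixes y s :: real
  assumes "1 \<le> y" "y \<le> 2" "- 1 \<le> s"
  shows "1 / 2 \<le> y powr s"
proof (cases "0 \<le> s")
  case True
  then have "1 \<le> y powr s"
    using assms by (simp add: ge_one_powr_ge_zero)
  then show ?thesis by simp
next
  case False
  have "1 / 2 = (2::real) powr - 1"
    by (simp add: powr_minus_divide)
  also have "\<dots> \<le> 2 powr s"
    using assms by (intro powr_mono) auto
  also have "\<dots> \<le> y powr s"
    using False assms by (intro powr_mono2') auto
  finally show ?thesis .
qed

context gap_system
begin

section \<open>Area integrals of the limit functions\<close>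

lemma exists_annulus:
  assumes "norm (z::complex) < 1"
  obtains n where "1 - 1 / L ^ n \<le> norm z" "norm z \<le> 1 - 1 / L ^ Suc n"
proof -
  let ?P = "\<lambda>n. norm z \<le> 1 - 1 / real (L ^ Suc n)"
  obtain m where m: "1 / (1 - norm z) < real L ^ m"
    using real_arch_pow[of "real L" "1 / (1 - norm z)"] L_ge(1) by auto
  have "real L ^ m \<le> real L ^ Suc m"
    using L_ge(1) by (intro power_increasing) auto
  with m have "1 / (1 - norm z) < real L ^ Suc m" by linarith
  moreover have "0 < real L ^ Suc m" using L_ge(1) by simp
  moreover have "1 / M \<le> a" if "1 / a < M" "0 < a" "0 < M" for a M :: real
    using that by (simp add: field_simps)
  ultimately have "1 / real L ^ Suc m \<le> 1 - norm z"
    using assms by simp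
  then have ex: "?P m" by simp
  define n where "n = (LEAST n. ?P n)"
  have "?P n" unfolding n_def by (rule LeastI[of ?P m]) (rule ex)
  moreover have "1 - 1 / L ^ n \<le> norm z"
  proof (cases n)
    case (Suc k)
    then have "\<not> ?P k"
      using not_less_Least[of k ?P] by (simp add: n_def)
    then show ?thesis using Suc by simp
  qed simp
  ultimately show thesis using that by blast
qed

text \<open>On the n-th annulus 1 - |z| is comparable to L^(-n), so the integrand is at most a
  constant times L^(-n (p - 1)) (b n L^n)^p = (b n)^p L^n, while the area is at most a constant
  times L^(-n). What remains is the series of the (b n)^p.\<close>

lemma in_dirichlet_type:
  assumes "start u v" "F holomorphic_on ball 0 1"
    and F': "\<And>z. z \<in> ball 0 1 \<Longrightarrow> (\<lambda>n. of_real (b n) * block' u v n z) sums deriv F z"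
    and p: "0 < p" and sm: "summable (\<lambda>n. b n powr p)"
  shows "F \<in> dirichlet_type p"
proof -
  define A where "A n = {z::complex. 1 - 1 / L ^ n \<le> norm z \<and> norm z \<le> 1 - 1 / L ^ Suc n}" for n
  have A[measurable]: "A n \<in> sets borel" for n
    unfolding A_def by measurable
  define c where "c = L powr \<bar>p - 1\<bar> * (50 * C * L) powr p"
  have c: "0 \<le> c" by (simp add: c_def)
  have ptw: "(1 - norm z) powr (p - 1) * norm (deriv F z) powr p / pi \<le> c * b n powr p * L ^ n" if z: "z \<in> A n" for z n
  proof -
    define m where "m = real L ^ n"
    have m: "1 \<le> m" using L_pow_ge_1 by (simp add: m_def)
    have L0: "1 \<le> real L" using L_ge(1) by simp
    have "0 < 1 / real (L ^ Suc n)"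
      using L0 by (intro divide_pos_pos) auto
    then have z1: "norm z < 1"
      using z unfolding A_def mem_Collect_eq by linarith
    define y where "y = (1 - norm z) * m"
    have y: "1 / L \<le> y" "y \<le> 1"
      using z m L0 by (auto simp: y_def A_def m_def field_simps)
    have x: "1 - norm z = y * (1 / m)"
      using m by (simp add: y_def)
    have "(1 - norm z) powr (p - 1) = y powr (p - 1) * (1 / m) powr (p - 1)"
      unfolding x by (rule powr_mult)
    also have "\<dots> \<le> L powr \<bar>p - 1\<bar> * (1 / m) powr (p - 1)"
      using y L0 by (intro mult_right_mono powr_le_on_unit) auto
    finally have 1: "(1 - norm z) powr (p - 1) \<le> L powr \<bar>p - 1\<bar> * (1 / m) powr (p - 1)" .
    have "norm (deriv F z) \<le> 50 * C * L * (b n * m)"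
      using deriv_limit_le[OF assms(1), of z n] F'[of z] z z1 by (simp add: A_def m_def)
    then have "norm (deriv F z) powr p \<le> (50 * C * L * (b n * m)) powr p"
      using p by (intro powr_mono2) auto
    also have "\<dots> = (50 * C * L) powr p * (b n powr p * m powr p)"
      using C_ge_1 b_pos[of n] m by (simp add: powr_mult less_imp_le)
    finally have 2: "norm (deriv F z) powr p \<le> (50 * C * L) powr p * (b n powr p * m powr p)" .
    have 3: "(1 / m) powr (p - 1) * m powr p = m"
    proof -
      have "(1 / m) powr (p - 1) = m powr (1 - p)"
        using m by (simp add: powr_divide powr_diff)
      then show ?thesis
        using m by (simp flip: powr_add)
    qed
    have "(1 - norm z) powr (p - 1) * norm (deriv F z) powr p / pi \<le> (1 - norm z) powr (p - 1) * norm (deriv F z) powr p / 1"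
      using pi_ge_two by (intro divide_left_mono) auto
    also have "\<dots> \<le> (L powr \<bar>p - 1\<bar> * (1 / m) powr (p - 1)) * ((50 * C * L) powr p * (b n powr p * m powr p))"
      using mult_mono[OF 1 2] by simp
    also have "\<dots> = c * b n powr p * ((1 / m) powr (p - 1) * m powr p)"
      by (simp add: c_def mult_ac)
    finally show ?thesis
      unfolding 3 by (simp add: m_def)
  qed
  have area: "emeasure lborel (A n) \<le> ennreal (2 * pi / L ^ n)" for n
  proof -
    define x where "x = 1 / real L ^ n"
    define x' where "x' = 1 / real L ^ Suc n"
    have x: "0 < x'" "x' \<le> x" "x \<le> 1"
      using L_ge(1) L_pow_ge_1[of n] by (auto simp: x_def x'_def intro!: divide_left_mono power_increasing)
    have "emeasure lborel (A n) = ennreal (pi * ((1 - x')\<^sup>2 - (1 - x)\<^sup>2))"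
      unfolding A_def using x emeasure_annulus[of "1 - x" "1 - x'"] by (simp add: x_def x'_def)
    also have "\<dots> \<le> ennreal (pi * (2 * x))"
    proof (intro ennreal_leI mult_left_mono)
      have "(1 - x')\<^sup>2 \<le> 1"
        using x power_le_one[of "1 - x'" 2] by auto
      moreover have "(1 - x)\<^sup>2 = 1 - 2 * x + x\<^sup>2"
        by (simp add: power2_eq_square algebra_simps)
      ultimately show "(1 - x')\<^sup>2 - (1 - x)\<^sup>2 \<le> 2 * x"
        using zero_le_power2[of x] by linarith
    qed simp
    finally show ?thesis by (simp add: x_def mult.commute)
  qed
  have "(\<integral>\<^sup>+ z. indicator (ball 0 1) z * ennreal ((1 - norm z) powr (p - 1) * norm (deriv F z) powr p / pi) \<partial>lborel)
      \<le> (\<integral>\<^sup>+ z. (\<Sum>n. ennreal (c * b n powr p * L ^ n) * indicator (A n) z) \<partial>lborel)"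
  proof (intro nn_integral_mono)
    fix z :: complex
    show "indicator (ball 0 1) z * ennreal ((1 - norm z) powr (p - 1) * norm (deriv F z) powr p / pi)
        \<le> (\<Sum>n. ennreal (c * b n powr p * L ^ n) * indicator (A n) z)"
    proof (cases "norm z < 1")
      case True
      then obtain n where n: "z \<in> A n"
        using exists_annulus[of z] unfolding A_def by blast
      have "indicator (ball 0 1) z * ennreal ((1 - norm z) powr (p - 1) * norm (deriv F z) powr p / pi)
          \<le> ennreal (c * b n powr p * L ^ n) * indicator (A n) z"
        using True n ptw[OF n] by (simp add: ennreal_leI)
      also have "\<dots> = sum (\<lambda>n. ennreal (c * b n powr p * L ^ n) * indicator (A n) z) {n}"
        by (subst sum.insert) (simp_all del: sum_mult_indicator)
      also have "\<dots> \<le> (\<Sum>n. ennreal (c * b n powr p * L ^ n) * indicator (A n) z)"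
        by (rule sum_le_suminf) auto
      finally show ?thesis .
    qed simp
  qed
  also have "\<dots> = (\<Sum>n. ennreal (c * b n powr p * L ^ n) * emeasure lborel (A n))"
    by (subst nn_integral_suminf) (auto simp: nn_integral_cmult)
  also have "\<dots> \<le> (\<Sum>n. ennreal (2 * pi * c * b n powr p))"
  proof (rule suminf_le)
    fix n
    have "ennreal (c * b n powr p * L ^ n) * emeasure lborel (A n) \<le> ennreal (c * b n powr p * L ^ n) * ennreal (2 * pi / L ^ n)"
      by (intro mult_left_mono area) simp
    also have "\<dots> = ennreal (2 * pi * c * b n powr p)"
      using c L_ge(1) by (subst ennreal_mult[symmetric]) auto
    finally show "ennreal (c * b n powr p * L ^ n) * emeasure lborel (A n) \<le> ennreal (2 * pi * c * b n powr p)" .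
  qed auto
  also have "\<dots> < \<infinity>"
  proof -
    have "(\<Sum>n. ennreal (2 * pi * c * b n powr p)) \<noteq> top"
      by (rule ennreal_suminf_neq_top[OF summable_mult[OF sm]]) (use c in auto)
    then show ?thesis unfolding infinity_ennreal_def by (simp only: less_top)
  qed
  finally show ?thesis
    using assms(2) by (simp add: dirichlet_type_def)
qed

text \<open>At scale n the weight and the derivatives give a multiple of (b n)^q L^n, and the
  integral of |g|^q is at least a multiple of the area, hence of L^(-n); each annulus contributes a
  multiple of (b n)^q. The two derivatives enter as a sum because which of them is large depends on
  the point.\<close>

lemma weighted_integral_infinite:
  assumes g: "g holomorphic_on ball 0 1" "z0 \<in> ball 0 1" "g z0 \<noteq> 0"
    and F: "\<And>z. z \<in> ball 0 1 \<Longrightarrow> (\<lambda>n. of_real (b n) * block' 1 0 n z) sums deriv F z"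
    and G: "\<And>z. z \<in> ball 0 1 \<Longrightarrow> (\<lambda>n. of_real (b n) * block' 0 1 n z) sums deriv G z"
    and q: "0 < q" and nsm: "\<not> summable (\<lambda>n. b n powr q)"
  shows "(\<integral>\<^sup>+ z. indicator (ball 0 1) z * ennreal ((1 - norm z) powr (q - 1) *
      ((norm (deriv F z) powr q + norm (deriv G z) powr q) * norm (g z) powr q)) \<partial>lborel) = \<infinity>"
proof -
  obtain \<kappa> where \<kappa>: "0 < \<kappa>"
    "\<And>\<alpha> \<beta>. 1 / 2 \<le> \<alpha> \<Longrightarrow> \<beta> < 1 \<Longrightarrow> ennreal \<kappa> * emeasure lborel {z::complex. \<alpha> \<le> norm z \<and> norm z \<le> \<beta>} \<le>
       (\<integral>\<^sup>+z. ennreal (norm (g z) powr q) * indicator {z. \<alpha> \<le> norm z \<and> norm z \<le> \<beta>} z \<partial>lborel)"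
    using annulus_lower_bound[OF g q] by blast
  \<comment> \<open>The shift to scale n + 1 gives x n <= 1 / 4, so that all annuli lie in |z| >= 1
    / 2, and it makes the stage at least 1, as the lower bound for \<open>Q\<close> demands.\<close>
  define x where "x n = 1 / real (L ^ Suc n)" for n
  have L4: "4 \<le> real L" and L0: "0 < real L" using L_ge(1) by auto
  have x: "0 < x n" "x n \<le> 1 / 4" for n
  proof -
    show "0 < x n" using L0 by (simp add: x_def)
    have "real L \<le> real L ^ Suc n"
      using L4 by (intro self_le_power) auto
    then have "4 \<le> real (L ^ Suc n)"
      using order_trans[OF L4] unfolding of_nat_power by blast
    then have "1 / real (L ^ Suc n) \<le> 1 / 4"
      using L0 by (intro divide_left_mono) (auto simp del: power_Suc of_nat_power)
    then show "x n \<le> 1 / 4" by (simp add: x_def)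
  qed
  define A where "A n = {z::complex. 1 - 2 * x n \<le> norm z \<and> norm z \<le> 1 - x n}" for n
  have A[measurable]: "A n \<in> sets borel" for n
    unfolding A_def by measurable
  have A_ball: "A n \<subseteq> ball 0 1" for n
    using x[of n] by (auto simp: A_def)
  \<comment> \<open>A lower bound for the weight times the derivative terms: 1 / 2 comes from the
    weight, 1 / 400 from the derivative, and 1 / x n is the power of L that the area
    cancels.\<close>
  define c where "c n = 1 / 2 * (1 / 400) powr q * b (Suc n) powr q / x n" for n
  have c: "0 \<le> c n" for n
    using x[of n] by (simp add: c_def)
  have ptw: "c n \<le> (1 - norm z) powr (q - 1) * (norm (deriv F z) powr q + norm (deriv G z) powr q)"
    if z: "z \<in> A n" for n z
  proof -
    define m where "m = real (L ^ Suc n)"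
    have m: "0 < m" using L0 by (simp add: m_def)
    have xm: "x n = 1 / m" by (simp add: x_def m_def)
    have zb: "z \<in> ball 0 1" using z A_ball by blast
    have "1 \<le> (1 - norm z) * m" "(1 - norm z) * m \<le> 2"
      using z m by (auto simp: A_def xm field_simps)
    then have "1 / 2 \<le> ((1 - norm z) * m) powr (q - 1)"
      using q by (intro powr_ge_on_doubling) auto
    also have "\<dots> = (1 - norm z) powr (q - 1) * m powr (q - 1)"
      by (rule powr_mult)
    finally have "1 / 2 * m powr (1 - q) \<le> (1 - norm z) powr (q - 1) * m powr (q - 1) * m powr (1 - q)"
      by (intro mult_right_mono) auto
    also have "\<dots> = (1 - norm z) powr (q - 1)"
      using m by (simp add: mult.assoc flip: powr_add)
    finally have 1: "1 / 2 * m powr (1 - q) \<le> (1 - norm z) powr (q - 1)" .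
    have two: "1 - 2 / L ^ Suc n \<le> norm z" "norm z \<le> 1 - 1 / L ^ Suc n"
      using z by (auto simp: A_def x_def)
    obtain u v where uv: "start u v" "1 / 2 \<le> norm (Q u v (Suc n) z)"
      using norm_Q_near_circle[OF _ two(1)] zb by auto
    from uv(1) have "(b (Suc n) * m / 400) powr q \<le> norm (deriv F z) powr q + norm (deriv G z) powr q"
      unfolding start_def
    proof
      assume "u = 1 \<and> v = 0"
      then have "(\<lambda>n. of_real (b n) * block' u v n z) sums deriv F z"
        using F[OF zb] by simp
      then have "b (Suc n) * m / 400 \<le> norm (deriv F z)"
        unfolding m_def by (intro deriv_limit_ge[OF _ two uv]) simp_all
      then have "(b (Suc n) * m / 400) powr q \<le> norm (deriv F z) powr q"
        using q m b_pos[of "Suc n"] by (intro powr_mono2) auto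
      then show ?thesis by (simp add: add_increasing2)
    next
      assume "u = 0 \<and> v = 1"
      then have "(\<lambda>n. of_real (b n) * block' u v n z) sums deriv G z"
        using G[OF zb] by simp
      then have "b (Suc n) * m / 400 \<le> norm (deriv G z)"
        unfolding m_def by (intro deriv_limit_ge[OF _ two uv]) simp_all
      then have "(b (Suc n) * m / 400) powr q \<le> norm (deriv G z) powr q"
        using q m b_pos[of "Suc n"] by (intro powr_mono2) auto
      then show ?thesis by (simp add: add_increasing)
    qed
    from mult_mono[OF 1 this] have "1 / 2 * m powr (1 - q) * (b (Suc n) * m / 400) powr q
        \<le> (1 - norm z) powr (q - 1) * (norm (deriv F z) powr q + norm (deriv G z) powr q)"
      by simp
    moreover have "1 / 2 * m powr (1 - q) * (b (Suc n) * m / 400) powr q = c n"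
    proof -
      have "(b (Suc n) * m / 400) powr q = (1 / 400) powr q * b (Suc n) powr q * m powr q"
        using powr_mult[of "1 / 400 * b (Suc n)" m q] powr_mult[of "1 / 400" "b (Suc n)" q]
        by (simp add: mult_ac)
      moreover have "m powr (1 - q) * m powr q = m"
        using m by (simp flip: powr_add)
      ultimately show ?thesis
        by (simp add: c_def xm mult_ac)
    qed
    ultimately show ?thesis by simp
  qed
  \<comment> \<open>As L > 2, a later annulus lies strictly closer to the circle than an earlier
    one. So the series of indicators below has at most one nonzero term at each point.\<close>
  have disj: "m = n" if "z \<in> A m" "z \<in> A n" for m n z
  proof -
    have *: "z \<notin> A n" if "z \<in> A m" "m < n" for m n
    proof -
      have "2 * L ^ Suc m < L ^ Suc n"
      proof -
        have "2 * L ^ Suc m < L * L ^ Suc m"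
          using L4 by (intro mult_strict_right_mono) auto
        also have "\<dots> = L ^ Suc (Suc m)" by simp
        also have "\<dots> \<le> L ^ Suc n"
          using that(2) L4 by (intro power_increasing) auto
        finally show ?thesis .
      qed
      then have "2 * real (L ^ Suc m) < real (L ^ Suc n)"
        by (metis of_nat_less_iff of_nat_mult of_nat_numeral)
      moreover have "2 / N < 1 / M" if "2 * M < N" "0 < M" for M N :: real
        using that by (simp add: field_simps)
      ultimately have "2 * x n < x m"
        using L0 by (simp add: x_def)
      then show ?thesis using that(1) by (auto simp: A_def)
    qed
    show ?thesis using *[of m n] *[of n m] that by (metis linorder_neqE_nat)
  qed
  have cont: "continuous_on (ball 0 1) (\<lambda>z. norm (g z) powr q)"
    using q by (intro continuous_on_powr' continuous_on_norm continuous_on_const holomorphic_on_imp_continuous_on g(1)) auto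
  have meas[measurable]: "(\<lambda>z. ennreal (norm (g z) powr q) * indicator (A n) z) \<in> borel_measurable borel" for n
    by (rule borel_measurable_ball_restrict[OF cont A A_ball])
  define k where "k = 1 / 2 * (1 / 400) powr q * \<kappa> * pi"
  have k: "0 < k" using \<kappa>(1) by (simp add: k_def)
  have "(\<Sum>n. ennreal (k * b (Suc n) powr q)) = \<infinity>"
  proof (rule ccontr)
    assume "(\<Sum>n. ennreal (k * b (Suc n) powr q)) \<noteq> \<infinity>"
    then have "summable (\<lambda>n. k * b (Suc n) powr q)"
      using k by (intro summable_suminf_not_top) auto
    then have "summable (\<lambda>n. b (Suc n) powr q)"
      using k by (simp add: summable_cmult_iff)
    then show False
      using nsm by (simp add: summable_Suc_iff[of "\<lambda>n. b n powr q"])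
  qed
  then have "\<infinity> = (\<Sum>n. ennreal (k * b (Suc n) powr q))"
    by simp
  also have "(\<Sum>n. ennreal (k * b (Suc n) powr q))
      \<le> (\<Sum>n. ennreal (c n) * (\<integral>\<^sup>+z. ennreal (norm (g z) powr q) * indicator (A n) z \<partial>lborel))"
  proof (rule suminf_le)
    fix n
    have "x n * pi \<le> pi * ((1 - x n)\<^sup>2 - (1 - 2 * x n)\<^sup>2)"
    proof -
      have "(1 - x n)\<^sup>2 - (1 - 2 * x n)\<^sup>2 - x n = x n * (1 - 3 * x n)"
        by (simp add: power2_eq_square algebra_simps)
      moreover have "0 \<le> x n * (1 - 3 * x n)"
        using x[of n] by simp
      ultimately have "x n \<le> (1 - x n)\<^sup>2 - (1 - 2 * x n)\<^sup>2"
        by linarith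
      then show ?thesis by (simp add: mult.commute)
    qed
    then have "ennreal (x n * pi) \<le> emeasure lborel (A n)"
      unfolding A_def using x[of n] by (subst emeasure_annulus) (auto intro: ennreal_leI)
    then have "ennreal \<kappa> * ennreal (x n * pi) \<le> ennreal \<kappa> * emeasure lborel (A n)"
      by (rule mult_left_mono) simp
    also have "\<dots> \<le> (\<integral>\<^sup>+z. ennreal (norm (g z) powr q) * indicator (A n) z \<partial>lborel)"
      unfolding A_def using x[of n] by (intro \<kappa>(2)) auto
    finally have "ennreal (c n) * (ennreal \<kappa> * ennreal (x n * pi))
        \<le> ennreal (c n) * (\<integral>\<^sup>+z. ennreal (norm (g z) powr q) * indicator (A n) z \<partial>lborel)"
      by (rule mult_left_mono) simp
    moreover have "ennreal (c n) * (ennreal \<kappa> * ennreal (x n * pi)) = ennreal (c n * (\<kappa> * (x n * pi)))"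
      using c[of n] \<kappa>(1) x[of n] by (simp add: ennreal_mult)
    moreover have "c n * (\<kappa> * (x n * pi)) = k * b (Suc n) powr q"
      using x[of n] by (simp add: c_def k_def)
    ultimately show "ennreal (k * b (Suc n) powr q)
        \<le> ennreal (c n) * (\<integral>\<^sup>+z. ennreal (norm (g z) powr q) * indicator (A n) z \<partial>lborel)"
      by simp
  qed auto
  also have "\<dots> = (\<integral>\<^sup>+z. (\<Sum>n. ennreal (c n) * (ennreal (norm (g z) powr q) * indicator (A n) z)) \<partial>lborel)"
    by (subst nn_integral_suminf) (auto simp: nn_integral_cmult)
  also have "\<dots> \<le> (\<integral>\<^sup>+ z. indicator (ball 0 1) z * ennreal ((1 - norm z) powr (q - 1) *
      ((norm (deriv F z) powr q + norm (deriv G z) powr q) * norm (g z) powr q)) \<partial>lborel)"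
  proof (rule nn_integral_mono)
    fix z :: complex
    show "(\<Sum>n. ennreal (c n) * (ennreal (norm (g z) powr q) * indicator (A n) z)) \<le>
       indicator (ball 0 1) z * ennreal ((1 - norm z) powr (q - 1) *
      ((norm (deriv F z) powr q + norm (deriv G z) powr q) * norm (g z) powr q))"
    proof (cases "\<exists>n. z \<in> A n")
      case True
      then obtain n where n: "z \<in> A n" by blast
      then have "z \<notin> A m" if "m \<noteq> n" for m using disj that by blast
      then have "(\<Sum>n. ennreal (c n) * (ennreal (norm (g z) powr q) * indicator (A n) z))
          = (\<Sum>n\<in>{n}. ennreal (c n) * (ennreal (norm (g z) powr q) * indicator (A n) z))"
        by (intro suminf_finite) auto
      also have "\<dots> = ennreal (c n * norm (g z) powr q)"
        using n c[of n] by (simp add: ennreal_mult)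
      also have "\<dots> \<le> ennreal ((1 - norm z) powr (q - 1) *
        ((norm (deriv F z) powr q + norm (deriv G z) powr q) * norm (g z) powr q))"
        unfolding mult.assoc[symmetric] by (intro ennreal_leI mult_right_mono ptw[OF n]) auto
      finally show ?thesis
        using n A_ball[of n] by auto
    qed simp
  qed
  finally show ?thesis
    by (simp only: infinity_ennreal_def top_unique)
qed

end

text \<open>From f' g = (f g)' - f g' with f bounded, and (t + w)^q <= 2^q (t^q + w^q), which holds
  for every q > 0 by comparison with the larger summand. Measurability is recorded because two such
  integrals are added later.\<close>

lemma product_in_dirichlet_type_imp:
  assumes f: "f holomorphic_on ball 0 1" "\<And>z. z \<in> ball 0 1 \<Longrightarrow> norm (f z) \<le> B" "0 \<le> B"
    and g: "g \<in> dirichlet_type q" and fg: "(\<lambda>z. f z * g z) \<in> dirichlet_type q" and q: "0 < q"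
  shows "(\<lambda>z. indicator (ball 0 1) z * ennreal ((1 - norm z) powr (q - 1) * (norm (deriv f z) powr q * norm (g z) powr q)))
      \<in> borel_measurable lborel" (is "?M")
    and "(\<integral>\<^sup>+ z. indicator (ball 0 1) z * ennreal ((1 - norm z) powr (q - 1) *
      (norm (deriv f z) powr q * norm (g z) powr q)) \<partial>lborel) < \<infinity>" (is "?I")
proof -
  have gh: "g holomorphic_on ball 0 1"
    using g by (simp add: dirichlet_type_def)
  have meas: "(\<lambda>z. indicator (ball 0 1) z * ennreal ((1 - norm z) powr (q - 1) * h z)) \<in> borel_measurable borel"
    if h: "continuous_on (ball 0 1) h" for h :: "complex \<Rightarrow> real"
  proof -
    have "continuous_on (ball 0 1) (\<lambda>z::complex. (1 - norm z) powr (q - 1) * h z)"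
      using h by (intro continuous_intros) auto
    from borel_measurable_ball_restrict[OF this, of "ball 0 1"] show ?thesis
      by (simp add: mult.commute)
  qed
  have cont: "continuous_on (ball 0 1) (\<lambda>z. norm (h z) powr q)" if "h holomorphic_on ball 0 1" for h :: "complex \<Rightarrow> complex"
    using q by (intro continuous_on_powr' continuous_on_norm continuous_on_const holomorphic_on_imp_continuous_on that) auto
  have df: "deriv f holomorphic_on ball 0 1" and dg: "deriv g holomorphic_on ball 0 1"
    and dfg: "deriv (\<lambda>z. f z * g z) holomorphic_on ball 0 1"
    using f(1) gh by (auto intro!: holomorphic_deriv holomorphic_intros)
  show ?M
    using meas[OF continuous_on_mult[OF cont[OF df] cont[OF gh]]] by simp
  define I where "I h = (\<lambda>z. indicator (ball 0 1) z * ennreal ((1 - norm z) powr (q - 1) * norm (deriv h z) powr q / pi))"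
    for h :: "complex \<Rightarrow> complex"
  have I: "I h \<in> borel_measurable lborel" if "deriv h holomorphic_on ball 0 1" for h
    using meas[OF continuous_on_divide[OF cont[OF that] continuous_on_const, of pi]] by (simp add: I_def)
  \<comment> \<open>The factor \<open>pi\<close> undoes the normalisation of the area measure in
    \<open>I\<close>.\<close>
  define c d where "c = pi * 2 powr q" and "d = pi * 2 powr q * B powr q"
  have cd: "0 \<le> c" "0 \<le> d" by (auto simp: c_def d_def)
  have ptw: "indicator (ball 0 1) z * ennreal ((1 - norm z) powr (q - 1) * (norm (deriv f z) powr q * norm (g z) powr q))
      \<le> ennreal c * I (\<lambda>z. f z * g z) z + ennreal d * I g z" for z
  proof (cases "z \<in> ball 0 1")
    case True
    have "deriv (\<lambda>z. f z * g z) z = f z * deriv g z + deriv f z * g z"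
      using True f(1) gh holomorphic_on_imp_differentiable_at[OF _ open_ball]
      by (subst deriv_mult) (auto simp: mult.commute)
    then have "norm (deriv f z * g z) \<le> norm (deriv (\<lambda>z. f z * g z) z) + norm (f z) * norm (deriv g z)"
      by (metis add_diff_cancel_left' norm_mult norm_triangle_ineq4)
    also have "\<dots> \<le> norm (deriv (\<lambda>z. f z * g z) z) + B * norm (deriv g z)"
      using f(2)[OF True] by (intro add_left_mono mult_right_mono) auto
    finally have le: "norm (deriv f z) * norm (g z) \<le> norm (deriv (\<lambda>z. f z * g z) z) + B * norm (deriv g z)"
      by (simp add: norm_mult)
    have powr_add_le: "s powr q \<le> 2 powr q * (t powr q + w powr q)" if "0 \<le> s" "s \<le> t + w" "0 \<le> t" "0 \<le> w" for s t w :: real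
    proof -
      have "s powr q \<le> (2 * max t w) powr q"
        using that q by (intro powr_mono2) auto
      also have "\<dots> = 2 powr q * max t w powr q"
        by (rule powr_mult)
      also have "\<dots> \<le> 2 powr q * (t powr q + w powr q)"
        by (intro mult_left_mono) (auto simp: max_def add_increasing add_increasing2)
      finally show ?thesis .
    qed
    have "norm (deriv f z) powr q * norm (g z) powr q = (norm (deriv f z) * norm (g z)) powr q"
      by (simp add: powr_mult)
    also have "\<dots> \<le> 2 powr q * (norm (deriv (\<lambda>z. f z * g z) z) powr q + (B * norm (deriv g z)) powr q)"
      using le f(3) by (intro powr_add_le) auto
    finally have "norm (deriv f z) powr q * norm (g z) powr q
        \<le> 2 powr q * (norm (deriv (\<lambda>z. f z * g z) z) powr q + B powr q * norm (deriv g z) powr q)"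
      by (simp add: powr_mult)
    then have "(1 - norm z) powr (q - 1) * (norm (deriv f z) powr q * norm (g z) powr q)
        \<le> (1 - norm z) powr (q - 1) * (2 powr q * (norm (deriv (\<lambda>z. f z * g z) z) powr q + B powr q * norm (deriv g z) powr q))"
      by (rule mult_left_mono) simp
    also have "\<dots> = c * ((1 - norm z) powr (q - 1) * norm (deriv (\<lambda>z. f z * g z) z) powr q / pi)
        + d * ((1 - norm z) powr (q - 1) * norm (deriv g z) powr q / pi)"
      by (simp add: c_def d_def algebra_simps)
    finally show ?thesis
      using True cd by (simp add: I_def ennreal_leI flip: ennreal_mult ennreal_plus)
  qed simp
  have fin: "(\<integral>\<^sup>+z. I h z \<partial>lborel) < \<infinity>" if "h \<in> dirichlet_type q" for h
    using that by (simp add: dirichlet_type_def I_def)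
  have "(\<integral>\<^sup>+ z. indicator (ball 0 1) z * ennreal ((1 - norm z) powr (q - 1) *
      (norm (deriv f z) powr q * norm (g z) powr q)) \<partial>lborel)
      \<le> (\<integral>\<^sup>+z. ennreal c * I (\<lambda>z. f z * g z) z + ennreal d * I g z \<partial>lborel)"
    by (intro nn_integral_mono ptw)
  also have "\<dots> = ennreal c * (\<integral>\<^sup>+z. I (\<lambda>z. f z * g z) z \<partial>lborel) + ennreal d * (\<integral>\<^sup>+z. I g z \<partial>lborel)"
    using I[OF dfg] I[OF dg] by (simp add: nn_integral_add nn_integral_cmult)
  also have "\<dots> < \<infinity>"
    using fin[OF fg] fin[OF g] by (simp add: ennreal_mult_less_top)
  finally show ?I .
qed

section \<open>The multiplier space\<close>

text \<open>The doubling constant comes from n + 2 <= 2 (n + 1). With S the sum of the (b n)^2,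
  finite because 2 / q > 1, the products are at most exp S, so C = exp S >= 1 is large
  enough.\<close>

lemma gap_system_powr:
  fixes q :: real
  assumes q: "0 < q" "q < 2"
  obtains L C where "gap_system (\<lambda>n. (1 / real (Suc n)) powr (1 / q)) L C (2 powr (1 / q))"
proof -
  define b where "b n = (1 / real (Suc n)) powr (1 / q)" for n
  define K where "K = 2 powr (1 / q)"
  have sq: "(b n)\<^sup>2 = real (Suc n) powr (- (2 / q))" for n
  proof -
    have "(b n)\<^sup>2 = (1 / real (Suc n)) powr (1 / q + 1 / q)"
      by (simp only: b_def power2_eq_square powr_add)
    also have "\<dots> = real (Suc n) powr (- (2 / q))"
      by (simp add: powr_divide powr_minus_divide)
    finally show ?thesis .
  qed
  have "summable (\<lambda>n. real n powr (- (2 / q)))"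
    using q by (simp add: summable_real_powr_iff)
  then have sm: "summable (\<lambda>n. (b n)\<^sup>2)"
    unfolding sq by (subst summable_Suc_iff)
  define S where "S = (\<Sum>n. (b n)\<^sup>2)"
  have S: "0 \<le> S" unfolding S_def by (intro suminf_nonneg sm) simp
  define C where "C = exp S"
  define L where "L = nat \<lceil>10000 * C * K\<rceil>"
  have "gap_system b L C K"
  proof
    fix j n
    show "0 < b j" by (simp add: b_def)
    show "b j \<le> 1"
      using q powr_mono2[of "1 / q" "1 / real (Suc j)" 1] by (simp add: b_def)
    show "b (Suc j) \<le> b j"
      unfolding b_def using q by (intro powr_mono2) (auto intro!: divide_left_mono)
    show "b j \<le> K * b (Suc j)"
    proof -
      have "1 / real (Suc j) \<le> 2 * (1 / real (Suc (Suc j)))"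
        by (simp add: field_simps)
      then have "b j \<le> (2 * (1 / real (Suc (Suc j)))) powr (1 / q)"
        unfolding b_def using q by (intro powr_mono2) auto
      also have "\<dots> = K * b (Suc j)"
        unfolding b_def K_def by (rule powr_mult)
      finally show ?thesis .
    qed
    show "(\<Prod>j<n. 1 + (b j)\<^sup>2) \<le> C\<^sup>2"
    proof -
      have "(\<Prod>j<n. 1 + (b j)\<^sup>2) \<le> (\<Prod>j<n. exp ((b j)\<^sup>2))"
        by (intro prod_mono) auto
      also have "\<dots> = exp (\<Sum>j<n. (b j)\<^sup>2)"
        by (simp add: exp_sum)
      also have "\<dots> \<le> exp S"
        unfolding S_def using sm by (simp add: sum_le_suminf)
      also have "\<dots> \<le> C\<^sup>2"
        unfolding C_def using S self_le_power[of "exp S" 2] by simp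
      finally show ?thesis .
    qed
    show "1 \<le> C" using S by (simp add: C_def)
    show "1 \<le> K" using q by (simp add: K_def ge_one_powr_ge_zero)
    show "10000 * C * K \<le> real L"
      by (simp add: L_def C_def K_def)
  qed
  then show thesis
    by (intro that[of L C]) (simp add: b_def[abs_def] K_def)
qed

text \<open>Testing a multiplier on this function puts the multiplier itself into the target
  space.\<close>

lemma const_one_mem:
  assumes "0 < p"
  shows "(\<lambda>_. 1) \<in> dirichlet_type p \<inter> BMOA"
  using assms by (auto intro: bounded_holomorphic_in_BMOA[where B = 1] simp: dirichlet_type_def)

lemma multiplier_zero:
  fixes p q :: real
  assumes q: "0 < q" "q < p" "q < 2"
    and g: "g \<in> multipliers (dirichlet_type p \<inter> BMOA) (dirichlet_type q \<inter> BMOA)"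
    and z0: "z0 \<in> ball 0 1"
  shows "g z0 = 0"
proof (rule ccontr)
  assume nz: "g z0 \<noteq> 0"
  define b where "b n = (1 / real (Suc n)) powr (1 / q)" for n
  obtain L C where "gap_system (\<lambda>n. (1 / real (Suc n)) powr (1 / q)) L C (2 powr (1 / q))"
    using gap_system_powr q by blast
  then interpret gap_system b L C "2 powr (1 / q)"
    by (simp add: b_def[abs_def])
  \<comment> \<open>For s = p the exponent p / q exceeds 1; for s = q the harmonic series
    appears.\<close>
  have bp: "b n powr s = real (Suc n) powr (- (s / q))" for n s
    by (simp add: b_def powr_powr powr_divide powr_minus_divide)
  have sm: "summable (\<lambda>n. b n powr p)"
  proof -
    have "summable (\<lambda>n. real n powr (- (p / q)))"
      using q by (simp add: summable_real_powr_iff)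
    then show ?thesis unfolding bp by (subst summable_Suc_iff)
  qed
  have nsm: "\<not> summable (\<lambda>n. b n powr q)"
  proof -
    have "\<not> summable (\<lambda>n. real n powr (- (q / q)))"
      unfolding summable_real_powr_iff using q by simp
    then show ?thesis unfolding bp by (subst summable_Suc_iff)
  qed
  have gh: "g holomorphic_on ball 0 1" and mult: "\<And>f. f \<in> dirichlet_type p \<inter> BMOA \<Longrightarrow> (\<lambda>z. f z * g z) \<in> dirichlet_type q \<inter> BMOA"
    using g by (auto simp: multipliers_def)
  have gD: "g \<in> dirichlet_type q"
    using mult[OF const_one_mem] q by simp
  obtain F where F: "\<And>z. z \<in> ball 0 1 \<Longrightarrow> norm (F z) \<le> C" "F holomorphic_on ball 0 1"
    "\<And>z. z \<in> ball 0 1 \<Longrightarrow> (\<lambda>n. of_real (b n) * block' 1 0 n z) sums deriv F z"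
    using limit_function[of 1 0] by (auto simp: start_def)
  obtain G where G: "\<And>z. z \<in> ball 0 1 \<Longrightarrow> norm (G z) \<le> C" "G holomorphic_on ball 0 1"
    "\<And>z. z \<in> ball 0 1 \<Longrightarrow> (\<lambda>n. of_real (b n) * block' 0 1 n z) sums deriv G z"
    using limit_function[of 0 1] by (auto simp: start_def)
  have "F \<in> dirichlet_type p \<inter> BMOA"
    using in_dirichlet_type[of 1 0 F p] bounded_holomorphic_in_BMOA[of F C] F sm q by (auto simp: start_def)
  then have Fg: "(\<lambda>z. F z * g z) \<in> dirichlet_type q" using mult by blast
  have "G \<in> dirichlet_type p \<inter> BMOA"
    using in_dirichlet_type[of 0 1 G p] bounded_holomorphic_in_BMOA[of G C] G sm q by (auto simp: start_def)
  then have Gg: "(\<lambda>z. G z * g z) \<in> dirichlet_type q" using mult by blast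
  have C0: "0 \<le> C" using C_ge_1 by simp
  define I where "I f = (\<lambda>z. indicator (ball 0 1) z * ennreal ((1 - norm z) powr (q - 1) *
      (norm (deriv f z) powr q * norm (g z) powr q)))" for f :: "complex \<Rightarrow> complex"
  note IF = product_in_dirichlet_type_imp[OF F(2,1) C0 gD Fg q(1), folded I_def]
  note IG = product_in_dirichlet_type_imp[OF G(2,1) C0 gD Gg q(1), folded I_def]
  have "\<infinity> = (\<integral>\<^sup>+ z. indicator (ball 0 1) z * ennreal ((1 - norm z) powr (q - 1) *
      ((norm (deriv F z) powr q + norm (deriv G z) powr q) * norm (g z) powr q)) \<partial>lborel)"
    using weighted_integral_infinite[OF gh z0 nz F(3) G(3) q(1) nsm] by simp
  also have "\<dots> = (\<integral>\<^sup>+ z. I F z + I G z \<partial>lborel)"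
    by (intro nn_integral_cong)
       (simp add: I_def distrib_left distrib_right)
  also have "\<dots> = (\<integral>\<^sup>+ z. I F z \<partial>lborel) + (\<integral>\<^sup>+ z. I G z \<partial>lborel)"
    by (rule nn_integral_add[OF IF(1) IG(1)])
  also have "\<dots> < \<infinity>"
    using IF(2) IG(2) by simp
  finally show False by simp
qed

text \<open>The product f g is known to vanish on the disc only; since the disc is open, its
  derivative vanishes there too.\<close>

lemma vanishing_is_multiplier:
  assumes "0 < q" "g holomorphic_on ball 0 1" "\<And>z. z \<in> ball 0 1 \<Longrightarrow> g z = 0"
    and X: "\<And>f. f \<in> X \<Longrightarrow> f holomorphic_on ball 0 1"
  shows "g \<in> multipliers X (dirichlet_type q \<inter> BMOA)"
proof -
  have "(\<lambda>z. f z * g z) \<in> dirichlet_type q \<inter> BMOA" if "f \<in> X" for f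
  proof -
    have h: "(\<lambda>z. f z * g z) holomorphic_on ball 0 1"
      using X[OF that] assms(2) by (intro holomorphic_intros)
    have "deriv (\<lambda>z. f z * g z) z = 0" if "z \<in> ball 0 1" for z
    proof -
      have "((\<lambda>z. f z * g z) has_field_derivative 0) (at z)"
        by (rule has_field_derivative_transform_within_open[of "\<lambda>_. 0", OF _ open_ball that])
           (use assms(3) in auto)
      then show ?thesis by (rule DERIV_imp_deriv)
    qed
    then have *: "indicator (ball 0 1) z * ennreal ((1 - norm z) powr (q - 1) * norm (deriv (\<lambda>z. f z * g z) z) powr q / pi) = 0" for z
      by (cases "z \<in> ball 0 1") auto
    have "(\<lambda>z. f z * g z) \<in> dirichlet_type q"
      unfolding dirichlet_type_def mem_Collect_eq * using h by simp
    moreover have "(\<lambda>z. f z * g z) \<in> BMOA"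
      using h assms(3) by (intro bounded_holomorphic_in_BMOA[where B = 0]) auto
    ultimately show ?thesis by blast
  qed
  then show ?thesis using assms(2) by (simp add: multipliers_def)
qed

text \<open>Functions are total here, so the zero function of the disc is represented by all
  functions vanishing on it, with arbitrary values outside; this set plays the role of {0}.\<close>

theorem theorem8:
  fixes p q :: real
  assumes "0 < q" and "q < p" and "q < 2"
  shows "multipliers (dirichlet_type p \<inter> BMOA) (dirichlet_type q \<inter> BMOA)
           = {g. g holomorphic_on ball 0 1 \<and> (\<forall>z\<in>ball 0 1. g z = 0)}"
proof (intro set_eqI iffI)
  fix g assume "g \<in> multipliers (dirichlet_type p \<inter> BMOA) (dirichlet_type q \<inter> BMOA)"
  then show "g \<in> {g. g holomorphic_on ball 0 1 \<and> (\<forall>z\<in>ball 0 1. g z = 0)}"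
    using multiplier_zero[OF assms] by (auto simp: multipliers_def)
next
  fix g assume "g \<in> {g. g holomorphic_on ball 0 1 \<and> (\<forall>z\<in>ball 0 1. g z = 0)}"
  then show "g \<in> multipliers (dirichlet_type p \<inter> BMOA) (dirichlet_type q \<inter> BMOA)"
    using assms(1) by (intro vanishing_is_multiplier) (auto simp: dirichlet_type_def)
qed

end
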